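(* Let $p$ be a prime, $m$ a positive integer, $q=p^m$ with $q>2$, and $n=q^2+1$. Let $\lambda\in\mathbb{F}_{q^2}^*$ have multiplicative order $r$, where $r\mid(q-1)$ and $\nu_2(r)=\nu_2(q-1)$. Let $\delta\in\mathbb{F}_{q^4}$ be a primitive $rn$-th root of unity with $\delta^n=\lambda$. Let $g_1(x)=(x-\delta)(x-\delta^{q^2})$ and $g_{q^2-q+1}(x)=(x-\delta^{q^2-q+1})(x-\delta^{q^4-q^3+q^2})$, and let $\mathcal{C}(1,q^2-q+1)$ be the $\lambda$-constacyclic code of length $n$ over $\mathbb{F}_{q^2}$ with check polynomial $g_1(x)g_{q^2-q+1}(x)$. Then $\mathcal{C}(1,q^2-q+1)$ has parameters $[q^2+1,4,q^2-q]$ and weight enumerator \[ 1+(q^5-q)z^{q^2-q}+\frac{(q^4-1)(q-1)q^3}{2}\left(z^{q^2-1}+z^{q^2+1}\right)+(q^7-q^5+q^4-q^3+q-1)z^{q^2}. \] Furthermore, the supports of the minimum weight codewords of $\mathcal{C}(1,q^2-q+1)$ form a $3$-$(q^2+1,q^2-q,(q^2-q-1)(q-2))$ design. The dual code $\mathcal{C}(1,q^2-q+1)^\perp$ has parameters $[q^2+1,q^2-3,4]$, and the supports of its minimum weight codewords form a $3$-$(q^2+1,4,q-2)$ design.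
   Context: $\nu_2$ is the $2$-adic valuation. A $\lambda$-constacyclic code of length $n$ over $\mathbb{F}_{q^2}$ is an ideal of $\mathbb{F}_{q^2}[x]/\langle x^n-\lambda\rangle$; its check polynomial is $(x^n-\lambda)/g(x)$ where $g$ is the monic generator polynomial. The weight enumerator is $\sum_iA_iz^i$ with $A_i$ the number of codewords of weight $i$. A $t$-$(v,\kappa,\eta)$ design is a set of $\kappa$-subsets (blocks) of a $v$-set such that every $t$-subset lies in exactly $\eta$ blocks; here points are coordinate positions and blocks are the distinct supports of codewords of the given weight. *)

theory Defs
  imports "HOL-Computational_Algebra.Polynomial" "HOL-Computational_Algebra.Primes"
begin

definition mult_ord :: "'a::field \<Rightarrow> nat" where
  "mult_ord x = (LEAST k. 0 < k \<and> x ^ k = 1)"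

definition subfield_of_size :: "nat \<Rightarrow> 'a::field set" where
  "subfield_of_size Q = {x. x ^ Q = x}"

definition vecs :: "'a::field set \<Rightarrow> nat \<Rightarrow> (nat \<Rightarrow> 'a) set" where
  "vecs K n = {c. (\<forall>i<n. c i \<in> K) \<and> (\<forall>i\<ge>n. c i = 0)}"

definition poly_of_vec :: "nat \<Rightarrow> (nat \<Rightarrow> 'a::field) \<Rightarrow> 'a poly" where
  "poly_of_vec n c = (\<Sum>i<n. monom (c i) i)"

definition poly_over :: "'a::field set \<Rightarrow> 'a poly \<Rightarrow> bool" where
  "poly_over K a \<longleftrightarrow> (\<forall>i. coeff a i \<in> K)"

text \<open>The lambda-constacyclic code of length n over K with check polynomial h:
  the ideal of K[x]/(x^n - lambda) generated by g = (x^n - lambda)/h.\<close>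
definition constacyclic_code_check ::
  "'a::field set \<Rightarrow> nat \<Rightarrow> 'a \<Rightarrow> 'a poly \<Rightarrow> (nat \<Rightarrow> 'a) set" where
  "constacyclic_code_check K n lam h =
     (let g = (monom 1 n - [:lam:]) div h in
      {c \<in> vecs K n. \<exists>a. poly_over K a \<and>
           poly_of_vec n c = (a * g) mod (monom 1 n - [:lam:])})"

definition hweight :: "nat \<Rightarrow> (nat \<Rightarrow> 'a::zero) \<Rightarrow> nat" where
  "hweight n c = card {i. i < n \<and> c i \<noteq> 0}"

definition supp :: "nat \<Rightarrow> (nat \<Rightarrow> 'a::zero) \<Rightarrow> nat set" where
  "supp n c = {i. i < n \<and> c i \<noteq> 0}"

definition min_dist :: "nat \<Rightarrow> (nat \<Rightarrow> 'a::zero) set \<Rightarrow> nat" where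
  "min_dist n C = Min (hweight n ` (C - {(\<lambda>_. 0)}))"

definition dual_code :: "'a::field set \<Rightarrow> nat \<Rightarrow> (nat \<Rightarrow> 'a) set \<Rightarrow> (nat \<Rightarrow> 'a) set" where
  "dual_code K n C = {d \<in> vecs K n. \<forall>c\<in>C. (\<Sum>i<n. c i * d i) = 0}"

definition weight_enum :: "nat \<Rightarrow> (nat \<Rightarrow> 'a::zero) set \<Rightarrow> int poly" where
  "weight_enum n C = (\<Sum>i\<le>n. monom (int (card {c \<in> C. hweight n c = i})) i)"

definition blocks :: "nat \<Rightarrow> (nat \<Rightarrow> 'a::zero) set \<Rightarrow> nat \<Rightarrow> nat set set" where
  "blocks n C w = supp n ` {c \<in> C. hweight n c = w}"

definition is_design :: "nat \<Rightarrow> nat \<Rightarrow> nat \<Rightarrow> nat \<Rightarrow> nat set set \<Rightarrow> bool" where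
  "is_design t v k eta B \<longleftrightarrow>
     (\<forall>b\<in>B. b \<subseteq> {..<v} \<and> card b = k) \<and>
     (\<forall>T. T \<subseteq> {..<v} \<and> card T = t \<longrightarrow> card {b \<in> B. T \<subseteq> b} = eta)"

end

theory Submission
  imports Defs "HOL-Library.Product_Plus" "HOL-Library.FuncSet"
begin

text \<open>Write \<open>\<phi> x = x\<^sup>q\<close>, \<open>k\<close> and \<open>K\<close> for the subfields with \<open>q\<close> and \<open>q\<^sup>2\<close> elements. The points
  \<open>u\<^sub>i = \<delta>\<^sup>-\<^sup>i\<close> have norm over \<open>K\<close> in \<open>k\<close>, so \<open>u \<mapsto> u^(q\<^sup>2 - q + 1)\<close> agrees on them with \<open>\<phi>\<^sup>3\<close>,
  and the four roots of the check polynomial are the conjugates of \<open>\<delta>\<close>. Hence the codewords are the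
  value vectors of the \<open>k\<close>-linear maps \<open>L\<close> from the big field to \<open>K\<close>, and modulo \<open>k\<^sup>*\<close> the \<open>u\<^sub>i\<close> are
  exactly the points of norm in \<open>k\<close>, an elliptic quadric in \<open>PG(3, q)\<close>; here the 2-adic condition is used.
  Three points of the quadric are independent over \<open>k\<close> and their span meets it in a conic of \<open>q + 1\<close> points.
  A nonzero \<open>L\<close> has at most \<open>q\<^sup>3\<close> roots, so a nonzero word has 0, 1, 2 or \<open>q + 1\<close> zeros; the four
  frequencies follow from the first four power moments, because vanishing at \<open>t \<le> 3\<close> points
  leaves \<open>q^(8 - 2t)\<close> words. The conics form a Steiner system \<open>3-(q\<^sup>2 + 1, q + 1, 1)\<close>; its complements
  support the minimum weight words, and the 4-subsets of its blocks support those of the dual.\<close>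

section \<open>The field with \<open>q\<^sup>4\<close> elements\<close>

text \<open>Subtracting one of its elements carries a nonempty fibre into the kernel. Since
  \<open>B\<close> may be any set around the image, an upper bound on the image yields a lower bound
  on the kernel.\<close>

lemma card_le_kernel_times_image:
  fixes f :: "'a::ab_group_add \<Rightarrow> 'c::ab_group_add"
  assumes A: "finite A" and diff: "\<And>x y. x \<in> A \<Longrightarrow> y \<in> A \<Longrightarrow> x - y \<in> A"
    and hom: "\<And>x y. x \<in> A \<Longrightarrow> y \<in> A \<Longrightarrow> f (x - y) = f x - f y"
    and B: "f ` A \<subseteq> B" "finite B"
  shows "card A \<le> card {x \<in> A. f x = 0} * card B"
proof -
  have fib: "card {x \<in> A. f x = y} \<le> card {x \<in> A. f x = 0}" if y: "y \<in> f ` A" for y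
  proof -
    obtain a where a: "a \<in> A" "f a = y" using y by auto
    have "inj_on (\<lambda>x. x - a) {x \<in> A. f x = y}" by (auto simp: inj_on_def)
    moreover have "(\<lambda>x. x - a) ` {x \<in> A. f x = y} \<subseteq> {x \<in> A. f x = 0}"
      using a diff hom by auto
    ultimately show ?thesis
      by (rule card_inj_on_le) (use A in simp)
  qed
  have "card A = (\<Sum>y\<in>f ` A. card {x \<in> A. f x = y})"
    using sum.image_gen[OF A, of "\<lambda>_. 1::nat" f] by simp
  also have "\<dots> \<le> (\<Sum>y\<in>f ` A. card {x \<in> A. f x = 0})"
    by (rule sum_mono) (rule fib)
  also have "\<dots> = card {x \<in> A. f x = 0} * card (f ` A)" by simp
  also have "\<dots> \<le> card {x \<in> A. f x = 0} * card B"
    using B by (intro mult_le_mono2 card_mono)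
  finally show ?thesis .
qed

text \<open>Multiplication by \<open>x\<close> permutes the nonzero elements, so their product
  absorbs the factor \<open>x ^ card ?U\<close>, which is therefore 1.\<close>

lemma power_card_UNIV:
  fixes x :: "'a::{field,finite}"
  shows "x ^ card (UNIV :: 'a set) = x"
proof (cases "x = 0")
  case True
  then show ?thesis using finite_UNIV_card_ge_0[where ?'a = 'a] by simp
next
  case False
  let ?U = "UNIV - {0 :: 'a}"
  have "(\<Prod>y\<in>?U. x * y) = \<Prod>?U"
    by (rule prod.reindex_bij_witness[where i = "\<lambda>y. y / x" and j = "\<lambda>y. x * y"])
      (use False in simp_all)
  moreover have "(\<Prod>y\<in>?U. x * y) = x ^ card ?U * \<Prod>?U"
    by (simp add: prod.distrib)
  moreover have "\<Prod>?U \<noteq> 0" by simp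
  ultimately have "x ^ card ?U = 1" by simp
  moreover have "card (UNIV :: 'a set) = Suc (card ?U)"
    by (rule card.remove) simp_all
  ultimately show ?thesis by (simp only: power_Suc mult_1_right)
qed

text \<open>Translation by 1 permutes the field; comparing sums shows that the cardinality, a power
  of \<open>p\<close>, vanishes in the field.\<close>

lemma CHAR_eq_if_card_prime_power:
  assumes "prime p" "card (UNIV :: 'a::{field,finite} set) = p ^ e"
  shows "CHAR('a) = p"
proof -
  have "(\<Sum>x\<in>UNIV. x + 1 :: 'a) = \<Sum>UNIV"
    by (rule sum.reindex_bij_witness[of _ "\<lambda>x. x - 1" "\<lambda>x. x + 1"]) auto
  then have "of_nat (card (UNIV :: 'a set)) = (0 :: 'a)"
    by (simp add: sum.distrib)
  then have "of_nat p = (0 :: 'a)"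
    using assms(2) by simp
  then have "CHAR('a) dvd p"
    using of_nat_eq_0_iff_char_dvd by blast
  then show ?thesis
    using assms(1) CHAR_not_1'[where ?'a = 'a] unfolding prime_nat_iff by auto
qed

lemma card_roots_le_degree:
  fixes p :: "'a::field poly"
  assumes "p \<noteq> 0" "degree p \<le> d" "\<And>x. x \<in> A \<Longrightarrow> poly p x = 0"
  shows "card A \<le> d"
proof -
  have "card A \<le> card {x. poly p x = 0}"
    using assms poly_roots_finite by (intro card_mono) auto
  then show ?thesis
    using card_poly_roots_bound[OF assms(1)] assms(2) by linarith
qed

text \<open>The Frobenius map is a parameter of its own, so that it can be rewritten as an opaque
  automorphism; \<open>phi_add\<close> is where the characteristic enters.\<close>

locale quartic_field =
  fixes q :: nat and phi :: "'b::{field,finite} \<Rightarrow> 'b" ("\<phi>")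
  assumes q_gt2: "2 < q"
    and card_field: "card (UNIV :: 'b set) = q ^ 4"
    and phi_eq: "\<phi> x = x ^ q"
    and phi_add [simp]: "\<phi> (x + y) = \<phi> x + \<phi> y"
begin

definition "k = {x. \<phi> x = x}"
definition "K = {x. \<phi> (\<phi> x) = x}"

lemma phi_mult [simp]: "\<phi> (x * y) = \<phi> x * \<phi> y"
  by (simp add: phi_eq power_mult_distrib)

lemma phi_divide [simp]: "\<phi> (x / y) = \<phi> x / \<phi> y"
  by (simp add: phi_eq power_divide)

lemma phi_power [simp]: "\<phi> (x ^ i) = \<phi> x ^ i"
  by (simp add: phi_eq power_mult[symmetric] mult.commute)

lemma phi_0 [simp]: "\<phi> 0 = 0" and phi_1 [simp]: "\<phi> 1 = 1"
  using q_gt2 by (simp_all add: phi_eq)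

lemma phi_eq_0_iff [simp]: "\<phi> x = 0 \<longleftrightarrow> x = 0"
  using q_gt2 by (simp add: phi_eq)

lemma phi_minus [simp]: "\<phi> (- x) = - \<phi> x"
  using phi_add[of x "- x"] by (simp add: eq_neg_iff_add_eq_0 add.commute)

lemma phi_diff [simp]: "\<phi> (x - y) = \<phi> x - \<phi> y"
  using phi_add[of x "- y"] by simp

lemma phi_sum: "\<phi> (\<Sum>i\<in>I. f i) = (\<Sum>i\<in>I. \<phi> (f i))"
  by (induction I rule: infinite_finite_induct) auto

lemma phi_eq_iff [simp]: "\<phi> x = \<phi> y \<longleftrightarrow> x = y"
  using phi_eq_0_iff[of "x - y"] by simp

lemma phi2: "\<phi> (\<phi> x) = x ^ q\<^sup>2"
  by (simp add: phi_eq power_mult[symmetric] power2_eq_square)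

lemma phi3: "\<phi> (\<phi> (\<phi> x)) = x ^ q ^ 3"
  by (simp add: phi_eq power_mult[symmetric] power3_eq_cube)

lemma phi4 [simp]: "\<phi> (\<phi> (\<phi> (\<phi> x))) = x"
  using power_card_UNIV[of x]
  by (simp add: phi_eq power_mult[symmetric] card_field power4_eq_xxxx)

lemma k_closed:
  "0 \<in> k" "1 \<in> k" "x \<in> k \<Longrightarrow> - x \<in> k"
  "x \<in> k \<Longrightarrow> y \<in> k \<Longrightarrow> x + y \<in> k" "x \<in> k \<Longrightarrow> y \<in> k \<Longrightarrow> x - y \<in> k"
  "x \<in> k \<Longrightarrow> y \<in> k \<Longrightarrow> x * y \<in> k" "x \<in> k \<Longrightarrow> y \<in> k \<Longrightarrow> x / y \<in> k"
  "x \<in> k \<Longrightarrow> x ^ i \<in> k"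
  by (auto simp: k_def)

lemma K_closed:
  "0 \<in> K" "1 \<in> K" "x \<in> K \<Longrightarrow> - x \<in> K"
  "x \<in> K \<Longrightarrow> y \<in> K \<Longrightarrow> x + y \<in> K" "x \<in> K \<Longrightarrow> y \<in> K \<Longrightarrow> x - y \<in> K"
  "x \<in> K \<Longrightarrow> y \<in> K \<Longrightarrow> x * y \<in> K" "x \<in> K \<Longrightarrow> y \<in> K \<Longrightarrow> x / y \<in> K"
  by (auto simp: K_def)

lemma K_sum: "(\<And>i. i \<in> I \<Longrightarrow> f i \<in> K) \<Longrightarrow> sum f I \<in> K"
  by (induction I rule: infinite_finite_induct) (auto simp: K_closed)

lemma k_subset_K: "k \<subseteq> K"
  by (auto simp: k_def K_def)

lemma q_powers: "1 < q\<^sup>2" "q < q\<^sup>2" "q\<^sup>2 < q ^ 3" "q ^ 3 < q ^ 4"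
proof -
  show "1 < q\<^sup>2" using q_gt2 by (simp add: power2_eq_square) (metis One_nat_def less_1_mult less_trans one_less_numeral_iff semiring_norm(76))
  show "q < q\<^sup>2" "q\<^sup>2 < q ^ 3" "q ^ 3 < q ^ 4"
    using q_gt2 power_strict_increasing[of 1 2 q] power_strict_increasing[of 2 3 q]
      power_strict_increasing[of 3 4 q] by auto
qed

text \<open>With \<open>c = - 1\<close> this bounds a fixed field, with \<open>c = 1\<close> the set
  of elements negated by a power of \<phi>.\<close>

lemma card_roots_binomial:
  fixes c :: 'b
  assumes "1 < d"
  shows "card {x. x ^ d + c * x = 0} \<le> d"
proof -
  let ?p = "monom 1 d + [:0, c:]"
  have d: "degree ?p = d" and p: "lead_coeff ?p = 1"
    using assms by (auto simp: degree_add_eq_left degree_monom_eq coeff_pCons split: nat.split)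
  have "?p \<noteq> 0" using assms d by auto
  then show ?thesis
    by (rule card_roots_le_degree) (use d in \<open>auto simp: poly_monom mult.commute\<close>)
qed

text \<open>The upper bound counts roots. For the lower one, \<open>\<phi> (\<phi> x) - x\<close> is
  negated by the square of \<phi>, so this map has at most \<open>q\<^sup>2\<close> values on the
  \<open>q ^ 4\<close> elements, and its kernel is \<open>K\<close>.\<close>

lemma card_K: "card K = q\<^sup>2"
proof (rule antisym)
  show "card K \<le> q\<^sup>2"
    using card_roots_binomial[of "q\<^sup>2" "- 1"] q_powers by (simp add: K_def phi2)
  let ?B = "{x :: 'b. x ^ q\<^sup>2 + 1 * x = 0}"
  have "card (UNIV :: 'b set) \<le> card {x \<in> UNIV. \<phi> (\<phi> x) - x = 0} * card ?B"
    by (rule card_le_kernel_times_image) (auto simp: phi2[symmetric])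
  also have "\<dots> \<le> card K * q\<^sup>2"
    using card_roots_binomial[of "q\<^sup>2" 1] q_powers by (simp add: K_def)
  finally have "q\<^sup>2 * q\<^sup>2 \<le> card K * q\<^sup>2"
    by (simp add: card_field power2_eq_square power4_eq_xxxx)
  then show "q\<^sup>2 \<le> card K" by (rule mult_right_le_imp_le) (use q_gt2 in simp)
qed

text \<open>The same argument one level down: on \<open>K\<close> the map
  \<open>\<phi> x - x\<close> has kernel \<open>k\<close>, and its values are negated by
  \<phi>.\<close>

lemma card_k: "card k = q"
proof (rule antisym)
  show "card k \<le> q"
    using card_roots_binomial[of q "- 1"] q_gt2 by (simp add: k_def phi_eq)
  let ?B = "{x :: 'b. x ^ q + 1 * x = 0}"
  have "card K \<le> card {x \<in> K. \<phi> x - x = 0} * card ?B"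
    by (rule card_le_kernel_times_image) (auto simp: phi_eq[symmetric] K_closed, auto simp: K_def)
  also have "{x \<in> K. \<phi> x - x = 0} = k"
    using k_subset_K by (auto simp: k_def)
  also have "card k * card ?B \<le> card k * q"
    using card_roots_binomial[of q 1] q_gt2 by simp
  finally have "q * q \<le> card k * q"
    by (simp add: card_K power2_eq_square)
  then show "q \<le> card k" using q_gt2 by simp
qed

section \<open>The elliptic quadric\<close>

definition "Om = {x. x \<noteq> 0 \<and> x * \<phi> (\<phi> x) \<in> k}"

text \<open>With the norm \<open>N x = x * \<phi> (\<phi> x)\<close> to \<open>K\<close>, this is
  the polar form of the quadratic form \<open>N x - \<phi> (N x)\<close>, whose nonzero zeros make
  up \<open>Om\<close>.\<close>

definition "D x y = x * \<phi> (\<phi> y) + \<phi> (\<phi> x) * y - \<phi> (x * \<phi> (\<phi> y) + \<phi> (\<phi> x) * y)"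

text \<open>An element whose trace and norm over \<open>K\<close> lie in \<open>k\<close> has its Frobenius image among its conjugates over \<open>K\<close>.\<close>

lemma Om_trace_in_k:
  assumes "t \<in> Om" "t + \<phi> (\<phi> t) \<in> k"
  shows "t \<in> k"
proof -
  have T: "\<phi> t + \<phi> (\<phi> (\<phi> t)) = t + \<phi> (\<phi> t)" and N: "\<phi> t * \<phi> (\<phi> (\<phi> t)) = t * \<phi> (\<phi> t)"
    using assms by (auto simp: Om_def k_def)
  have "(\<phi> t - t) * (\<phi> t - \<phi> (\<phi> t)) = \<phi> t * \<phi> t - \<phi> t * (t + \<phi> (\<phi> t)) + t * \<phi> (\<phi> t)"
    by (simp add: algebra_simps)
  also have "\<dots> = 0" by (simp add: T[symmetric] N[symmetric] algebra_simps)
  finally have "\<phi> t = t \<or> \<phi> t = \<phi> (\<phi> t)" by simp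
  then show ?thesis by (auto simp: k_def)
qed

lemma Om_divide: "x \<in> Om \<Longrightarrow> y \<in> Om \<Longrightarrow> y / x \<in> Om"
  by (auto simp: Om_def k_def)

text \<open>For \<open>t = y / x\<close> the mixed term equals the norm of \<open>x\<close>, a
  nonzero element of \<open>k\<close>, times the trace of \<open>t\<close>. If \<open>D x y\<close>
  vanished, the trace would lie in \<open>k\<close>, and so would \<open>t\<close> by
  \<open>Om_trace_in_k\<close>.\<close>

lemma D_nonzero:
  assumes x: "x \<in> Om" and y: "y \<in> Om" and xy: "y / x \<notin> k"
  shows "D x y \<noteq> 0"
proof
  assume D: "D x y = 0"
  define t where "t = y / x"
  have x0: "x \<noteq> 0" and N: "\<phi> (x * \<phi> (\<phi> x)) = x * \<phi> (\<phi> x)"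
    using x by (auto simp: Om_def k_def)
  have y_eq: "y = t * x" using x0 by (simp add: t_def)
  have "x * \<phi> (\<phi> y) + \<phi> (\<phi> x) * y = x * \<phi> (\<phi> x) * (t + \<phi> (\<phi> t))"
    by (simp add: y_eq algebra_simps)
  moreover have "x * \<phi> (\<phi> y) + \<phi> (\<phi> x) * y = \<phi> (x * \<phi> (\<phi> y) + \<phi> (\<phi> x) * y)"
    using D unfolding D_def right_minus_eq .
  ultimately have "x * \<phi> (\<phi> x) * (t + \<phi> (\<phi> t)) = \<phi> (x * \<phi> (\<phi> x)) * \<phi> (t + \<phi> (\<phi> t))"
    by (metis phi_mult)
  then have "t + \<phi> (\<phi> t) = \<phi> (t + \<phi> (\<phi> t))"
    unfolding N using x0 by (simp only: mult_left_cancel mult_eq_0_iff phi_eq_0_iff simp_thms)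
  then have "t + \<phi> (\<phi> t) \<in> k"
    unfolding k_def mem_Collect_eq ..
  then have "t \<in> k"
    using Om_trace_in_k Om_divide[OF x y] by (simp add: t_def)
  then show False using xy by (simp add: t_def)
qed

text \<open>Expanding the quadratic form, the square terms drop out because the three vectors lie on
  the quadric; only the polar terms remain.\<close>

lemma Om_combination_iff:
  assumes "x1 \<in> k" "x2 \<in> k" "x3 \<in> k" "u1 \<in> Om" "u2 \<in> Om" "u3 \<in> Om"
  defines "v \<equiv> x1 * u1 + x2 * u2 + x3 * u3"
  shows "v * \<phi> (\<phi> v) \<in> k \<longleftrightarrow> x1 * x2 * D u1 u2 + x1 * x3 * D u1 u3 + x2 * x3 * D u2 u3 = 0"
proof -
  have x: "\<phi> x1 = x1" "\<phi> x2 = x2" "\<phi> x3 = x3"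
    using assms by (auto simp: k_def)
  have N: "\<phi> u * \<phi> (\<phi> (\<phi> u)) = u * \<phi> (\<phi> u)" if "u \<in> Om" for u
    using that by (auto simp: Om_def k_def)
  have "v * \<phi> (\<phi> v) - \<phi> (v * \<phi> (\<phi> v)) =
     x1 * x2 * D u1 u2 + x1 * x3 * D u1 u3 + x2 * x3 * D u2 u3
     + x1 * x1 * (u1 * \<phi> (\<phi> u1) - \<phi> u1 * \<phi> (\<phi> (\<phi> u1)))
     + x2 * x2 * (u2 * \<phi> (\<phi> u2) - \<phi> u2 * \<phi> (\<phi> (\<phi> u2)))
     + x3 * x3 * (u3 * \<phi> (\<phi> u3) - \<phi> u3 * \<phi> (\<phi> (\<phi> u3)))"
    by (simp add: v_def D_def x algebra_simps)
  then have "v * \<phi> (\<phi> v) - \<phi> (v * \<phi> (\<phi> v)) =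
     x1 * x2 * D u1 u2 + x1 * x3 * D u1 u3 + x2 * x3 * D u2 u3"
    using N assms(4-6) by simp
  then show ?thesis unfolding k_def mem_Collect_eq by (metis eq_iff_diff_eq_0)
qed

text \<open>All values of \<open>D\<close> are negated by \<phi>, so their quotients are fixed by
  it. Thus the equation of a plane section can be given coefficients in \<open>k\<close>.\<close>

lemma D_ratio:
  assumes "D u1 u2 \<noteq> 0"
  shows "D u3 u4 / D u1 u2 \<in> k"
proof -
  have "\<phi> (D x y) = - D x y" for x y
    by (simp add: D_def algebra_simps)
  then have "\<phi> (D u3 u4 / D u1 u2) = D u3 u4 / D u1 u2"
    by (simp only: phi_divide minus_divide_divide)
  then show ?thesis by (simp only: k_def mem_Collect_eq)
qed

section \<open>Planes through three points of the quadric and their conics\<close>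

definition "kspan u1 u2 u3 = (\<lambda>(x1, x2, x3). x1 * u1 + x2 * u2 + x3 * u3) ` (k \<times> k \<times> k)"

definition "general u1 u2 u3 \<longleftrightarrow> u1 \<in> Om \<and> u2 \<in> Om \<and> u3 \<in> Om \<and> u2 / u1 \<notin> k \<and> u3 / u1 \<notin> k \<and> u3 / u2 \<notin> k"

text \<open>No three points of the quadric are collinear: on the line through \<open>u1\<close> and
  \<open>u2\<close> the quadratic form is \<open>y1 * y2 * D u1 u2\<close>, which vanishes only at
  these two points.\<close>

lemma general_independent:
  assumes "general u1 u2 u3" "x1 \<in> k" "x2 \<in> k" "x3 \<in> k" "x1 * u1 + x2 * u2 + x3 * u3 = 0"
  shows "x1 = 0 \<and> x2 = 0 \<and> x3 = 0"
proof -
  have u: "u1 \<in> Om" "u2 \<in> Om" "u3 \<in> Om"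
    and r: "u2 / u1 \<notin> k" "u3 / u1 \<notin> k" "u3 / u2 \<notin> k"
    using assms(1) by (simp_all add: general_def)
  then have nz: "u1 \<noteq> 0" "u2 \<noteq> 0" "u3 \<noteq> 0" by (simp_all add: Om_def)
  have x3: "x3 = 0"
  proof (rule ccontr)
    assume x3: "x3 \<noteq> 0"
    define y1 y2 where "y1 = - x1 / x3" and "y2 = - x2 / x3"
    have y: "y1 \<in> k" "y2 \<in> k" using assms unfolding y1_def y2_def using k_closed(3,7) by blast+
    have "x3 * y1 = - x1" "x3 * y2 = - x2" using x3 by (simp_all add: y1_def y2_def)
    then have "x3 * (y1 * u1 + y2 * u2) = - x1 * u1 + - x2 * u2"
      by (simp only: distrib_left mult.assoc[symmetric])
    also have "\<dots> = x3 * u3" using assms(5) unfolding add_eq_0_iff by simp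
    finally have "x3 * u3 = x3 * (y1 * u1 + y2 * u2)" ..
    then have u3: "u3 = y1 * u1 + y2 * u2" using x3 by simp
    have "u3 * \<phi> (\<phi> u3) \<in> k" using u(3) by (simp add: Om_def)
    then have "y1 * y2 * D u1 u2 = 0"
      using Om_combination_iff[OF y k_closed(1) u] by (simp add: u3[symmetric])
    then have "y1 = 0 \<or> y2 = 0" using D_nonzero[OF u(1,2) r(1)] by auto
    then have "u3 / u2 = y2 \<or> u3 / u1 = y1" using u3 nz by auto
    then show False using y r by auto
  qed
  have "x2 = 0"
  proof (rule ccontr)
    assume x2: "x2 \<noteq> 0"
    have "x1 * u1 + x2 * u2 = 0" using assms(5) x3 by simp
    then have "x2 * u2 = - x1 * u1" unfolding add_eq_0_iff by simp
    then have "u2 / u1 = - x1 / x2" using x2 nz(1) by (simp only: frac_eq_eq not_False_eq_True mult.commute)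
    moreover have "- x1 / x2 \<in> k" using assms(2,3) k_closed(3,7) by blast
    ultimately show False using r(1) by simp
  qed
  then show ?thesis using assms(5) x3 nz by simp
qed

lemma general_coordinates_unique:
  assumes "general u1 u2 u3" "x1 \<in> k" "x2 \<in> k" "x3 \<in> k" "y1 \<in> k" "y2 \<in> k" "y3 \<in> k"
    and "x1 * u1 + x2 * u2 + x3 * u3 = y1 * u1 + y2 * u2 + y3 * u3"
  shows "x1 = y1 \<and> x2 = y2 \<and> x3 = y3"
  using general_independent[OF assms(1), of "x1 - y1" "x2 - y2" "x3 - y3"] assms(2-)
  by (simp add: k_closed left_diff_distrib add_diff_add[symmetric])

lemma general_inj_on:
  assumes "general u1 u2 u3"
  shows "inj_on (\<lambda>(x1, x2, x3). x1 * u1 + x2 * u2 + x3 * u3) (k \<times> k \<times> k)"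
  by (rule inj_onI) (use general_coordinates_unique[OF assms] in auto)

lemma card_span:
  assumes "general u1 u2 u3"
  shows "card (kspan u1 u2 u3) = q ^ 3"
  unfolding kspan_def
  by (simp add: card_image[OF general_inj_on[OF assms]] card_k card_cartesian_product power3_eq_cube)

text \<open>Solutions with \<open>x3 = 0\<close> lie on two axes, \<open>q - 1\<close> on each. For
  fixed nonzero \<open>x3\<close> the equation is linear in \<open>x2\<close> and has one solution
  for every \<open>x1\<close> except \<open>- c * x3\<close>, where it has none; this adds
  \<open>(q - 1) * (q - 1)\<close>.\<close>

lemma card_conic:
  assumes b: "b \<in> k" "b \<noteq> 0" and c: "c \<in> k" "c \<noteq> 0"
  shows "card {(x1, x2, x3). x1 \<in> k \<and> x2 \<in> k \<and> x3 \<in> k \<and> (x1, x2, x3) \<noteq> (0, 0, 0) \<and>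
      x1 * x2 + x1 * x3 * b + x2 * x3 * c = 0} = (q + 1) * (q - 1)" (is "card ?E = _")
proof -
  let ?k = "k - {0}"
  let ?A = "(\<lambda>x. (x, 0 :: 'b, 0 :: 'b)) ` ?k" and ?B = "(\<lambda>x. (0 :: 'b, x, 0 :: 'b)) ` ?k"
  let ?P = "Sigma ?k (\<lambda>z. k - {- c * z})"
  let ?f = "\<lambda>(z, x). (x, - b * x * z / (x + c * z), z)"
  have ck: "card ?k = q - 1" using card_k k_closed by simp
  have E: "?E = ?A \<union> ?B \<union> ?f ` ?P"
  proof (intro equalityI subsetI)
    fix e assume "e \<in> ?E"
    then obtain x y z where e: "e = (x, y, z)" "x \<in> k" "y \<in> k" "z \<in> k" "(x, y, z) \<noteq> (0, 0, 0)"
      and eq: "x * y + x * z * b + y * z * c = 0" by auto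
    show "e \<in> ?A \<union> ?B \<union> ?f ` ?P"
    proof (cases "z = 0")
      case True
      then show ?thesis using e eq by auto
    next
      case False
      have *: "y * (x + c * z) = - b * x * z" using eq by (simp add: algebra_simps eq_neg_iff_add_eq_0)
      have "x + c * z \<noteq> 0"
      proof
        assume xz: "x + c * z = 0"
        then have "x = 0" using * b(2) False by simp
        then show False using xz c(2) False by simp
      qed
      then have "y = - b * x * z / (x + c * z)"
        using * by (rule nonzero_eq_divide_eq[THEN iffD2])
      moreover have "x \<noteq> - c * z" using \<open>x + c * z \<noteq> 0\<close> by auto
      ultimately have "e = ?f (z, x)" "(z, x) \<in> ?P" using e False by auto
      then show ?thesis by blast
    qed
  next
    fix e assume "e \<in> ?A \<union> ?B \<union> ?f ` ?P"
    then consider "e \<in> ?A \<union> ?B" | z x where "(z, x) \<in> ?P" "e = ?f (z, x)" by auto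
    then show "e \<in> ?E"
    proof cases
      case 1
      then show ?thesis using k_closed by auto
    next
      case 2
      have nz: "x + c * z \<noteq> 0" using 2 by (auto simp: add_eq_0_iff)
      define y where "y = - b * x * z / (x + c * z)"
      have "y * (x + c * z) = - b * x * z" using nz by (simp add: y_def)
      moreover have "x * y + x * z * b + y * z * c = y * (x + c * z) + b * x * z"
        by (simp add: algebra_simps)
      ultimately have "x * y + x * z * b + y * z * c = 0" by simp
      moreover have "y \<in> k"
        unfolding y_def using b c 2 by (intro k_closed) auto
      moreover have "e = (x, y, z)" using 2(2) by (simp add: y_def)
      ultimately show ?thesis using 2(1) by simp
    qed
  qed
  have "card (?f ` ?P) = (q - 1) * (q - 1)"
  proof -
    have "inj_on ?f ?P" by (auto simp: inj_on_def)
    moreover have "card (k - {- c * z}) = q - 1" if "z \<in> k" for z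
      using that c card_k k_closed by (metis card_Diff_singleton)
    ultimately show ?thesis using ck by (simp add: card_image)
  qed
  moreover have "card ?A = q - 1" "card ?B = q - 1"
    using ck by (simp_all add: card_image inj_on_def)
  moreover have "card (?A \<union> ?B) = card ?A + card ?B"
    by (rule card_Un_disjoint) auto
  moreover have "card (?A \<union> ?B \<union> ?f ` ?P) = card (?A \<union> ?B) + card (?f ` ?P)"
    by (rule card_Un_disjoint) auto
  ultimately have "card ?E = (q - 1) + (q - 1) + (q - 1) * (q - 1)"
    unfolding E by (simp only:)
  also have "\<dots> = (q + 1) * (q - 1)"
    using q_gt2 by (cases q) (auto simp: algebra_simps)
  finally show ?thesis .
qed

text \<open>Dividing the equation of the section by \<open>D u1 u2\<close> brings it into the form
  of \<open>card_conic\<close>. Vectors are counted here, so each of the \<open>q + 1\<close> points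
  contributes its \<open>q - 1\<close> nonzero multiples.\<close>

lemma card_Om_span:
  assumes g: "general u1 u2 u3"
  shows "card (Om \<inter> kspan u1 u2 u3) = (q + 1) * (q - 1)"
proof -
  have u: "u1 \<in> Om" "u2 \<in> Om" "u3 \<in> Om"
    and D: "D u1 u2 \<noteq> 0" "D u1 u3 \<noteq> 0" "D u2 u3 \<noteq> 0"
    using g by (simp_all add: general_def D_nonzero)
  let ?b = "D u1 u3 / D u1 u2" and ?c = "D u2 u3 / D u1 u2"
  let ?E = "{(x1, x2, x3). x1 \<in> k \<and> x2 \<in> k \<and> x3 \<in> k \<and> (x1, x2, x3) \<noteq> (0, 0, 0) \<and>
      x1 * x2 + x1 * x3 * ?b + x2 * x3 * ?c = 0}"
  let ?f = "\<lambda>(x1, x2, x3). x1 * u1 + x2 * u2 + x3 * u3"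
  have conic: "x1 * x2 + x1 * x3 * ?b + x2 * x3 * ?c = 0 \<longleftrightarrow>
    x1 * x2 * D u1 u2 + x1 * x3 * D u1 u3 + x2 * x3 * D u2 u3 = 0" for x1 x2 x3
  proof -
    have "x1 * x2 * D u1 u2 + x1 * x3 * D u1 u3 + x2 * x3 * D u2 u3 =
      (x1 * x2 + x1 * x3 * ?b + x2 * x3 * ?c) * D u1 u2"
      using D by (simp add: field_simps)
    then show ?thesis using D by simp
  qed
  have "Om \<inter> kspan u1 u2 u3 = ?f ` ?E"
  proof (intro equalityI subsetI)
    fix v assume v: "v \<in> Om \<inter> kspan u1 u2 u3"
    then obtain x1 x2 x3 where x: "x1 \<in> k" "x2 \<in> k" "x3 \<in> k" "v = x1 * u1 + x2 * u2 + x3 * u3"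
      by (auto simp: kspan_def)
    have "v * \<phi> (\<phi> v) \<in> k" "v \<noteq> 0" using v unfolding Om_def by blast+
    then have "x1 * x2 + x1 * x3 * ?b + x2 * x3 * ?c = 0"
      unfolding conic x(4) Om_combination_iff[OF x(1-3) u] by blast
    moreover have "(x1, x2, x3) \<noteq> (0, 0, 0)" using \<open>v \<noteq> 0\<close> x(4) by auto
    ultimately have "(x1, x2, x3) \<in> ?E"
      using x(1-3) by (simp only: mem_Collect_eq case_prod_conv simp_thms)
    then show "v \<in> ?f ` ?E"
      by (rule rev_image_eqI) (simp only: x(4) case_prod_conv)
  next
    fix v assume "v \<in> ?f ` ?E"
    then obtain x1 x2 x3 where x: "x1 \<in> k" "x2 \<in> k" "x3 \<in> k" "v = x1 * u1 + x2 * u2 + x3 * u3"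
       "(x1, x2, x3) \<noteq> (0, 0, 0)" "x1 * x2 + x1 * x3 * ?b + x2 * x3 * ?c = 0"
      by (elim imageE) (simp only: mem_Collect_eq case_prod_beta, blast)
    have "v * \<phi> (\<phi> v) \<in> k"
      using x(6) unfolding conic x(4) Om_combination_iff[OF x(1-3) u] .
    moreover have "v \<noteq> 0" using general_independent[OF g x(1-3)] x(4,5) by auto
    ultimately have "v \<in> Om" by (simp only: Om_def mem_Collect_eq simp_thms)
    moreover have "v \<in> kspan u1 u2 u3"
      unfolding kspan_def x(4) by (rule image_eqI[of _ _ "(x1, x2, x3)"]) (use x in auto)
    ultimately show "v \<in> Om \<inter> kspan u1 u2 u3" ..
  qed
  moreover have "inj_on ?f ?E"
    by (rule inj_on_subset[OF general_inj_on[OF g]]) blast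
  moreover have "card ?E = (q + 1) * (q - 1)"
    by (rule card_conic) (simp_all only: D D_ratio[OF D(1)] divide_eq_0_iff simp_thms not_False_eq_True)
  ultimately show ?thesis by (simp only: card_image)
qed

section \<open>Semilinear forms\<close>

text \<open>This is the trace to \<open>K\<close> of \<open>a * x + c * \<phi> x\<close>: the last
  two terms are the images of the first two under the square of \<phi>.\<close>

definition "L a c x = a * x + c * \<phi> x + \<phi> (\<phi> a) * \<phi> (\<phi> x) + \<phi> (\<phi> c) * \<phi> (\<phi> (\<phi> x))"

lemma L_add: "L a c (x + y) = L a c x + L a c y"
  by (simp add: L_def algebra_simps)

lemma L_scale: "s \<in> k \<Longrightarrow> L a c (s * x) = s * L a c x"
  by (simp add: L_def k_def algebra_simps)

lemma L_diff_coeffs: "L (a - a') (c - c') x = L a c x - L a' c' x"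
  by (simp add: L_def algebra_simps)

lemma L_scale_coeffs: "s \<in> K \<Longrightarrow> L (s * a) (s * c) x = s * L a c x"
  by (simp add: L_def K_def algebra_simps)

lemma L_in_K: "L a c x \<in> K"
  by (simp add: L_def K_def algebra_simps)

text \<open>The form is a polynomial function of degree at most \<open>q ^ 3\<close>. Its four
  exponents are distinct, so \<open>a\<close> and \<open>c\<close> occur as coefficients and the
  polynomial is nonzero.\<close>

lemma card_L_roots:
  assumes "(a, c) \<noteq> (0, 0)"
  shows "card {x. L a c x = 0} \<le> q ^ 3"
proof -
  define p where "p = monom a 1 + monom c q + monom (\<phi> (\<phi> a)) (q\<^sup>2) + monom (\<phi> (\<phi> c)) (q ^ 3)"
  have "q \<noteq> 1" "q \<noteq> q\<^sup>2" "q \<noteq> q ^ 3" "q\<^sup>2 \<noteq> 1" "q ^ 3 \<noteq> 1"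
    using q_gt2 q_powers by linarith+
  then have "coeff p 1 = a" "coeff p q = c"
    by (simp_all add: p_def)
  then have "p \<noteq> 0" using assms by auto
  moreover have "degree p \<le> q ^ 3"
    unfolding p_def using q_gt2 q_powers
    by (intro degree_add_le degree_monom_le[THEN order_trans]) linarith+
  moreover have "poly p x = L a c x" for x
    by (simp add: p_def L_def poly_monom phi2[symmetric] phi3[symmetric] phi_eq[symmetric])
  ultimately show ?thesis by (intro card_roots_le_degree) auto
qed

lemma L_span:
  assumes "L a c u1 = 0" "L a c u2 = 0" "L a c u3 = 0" "x \<in> kspan u1 u2 u3"
  shows "L a c x = 0"
  using assms by (auto simp: kspan_def L_add L_scale)

text \<open>A nonzero form has at most \<open>q\<^sup>3\<close> roots, so it vanishes on nothing more than the span of three of them.\<close>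

lemma L_kernel_eq_span:
  assumes "general u1 u2 u3" "(a, c) \<noteq> (0, 0)" "L a c u1 = 0" "L a c u2 = 0" "L a c u3 = 0"
  shows "{x. L a c x = 0} = kspan u1 u2 u3"
proof -
  have "kspan u1 u2 u3 \<subseteq> {x. L a c x = 0}"
    using L_span[OF assms(3-5)] by blast
  then show ?thesis
    using card_L_roots[OF assms(2)] card_span[OF assms(1)]
    by (intro card_seteq[symmetric]) simp_all
qed

end

section \<open>Ovoid codes\<close>

text \<open>A list of pairwise nonproportional representatives of points of the quadric. That it
  meets every point is derived by counting in \<open>Om_eq\<close>. Weights, designs and the dual
  are treated at this level.\<close>

locale ovoid = quartic_field q phi
  for q :: nat and phi :: "'b::{field,finite} \<Rightarrow> 'b" ("\<phi>") +
  fixes n :: nat and u :: "nat \<Rightarrow> 'b"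
  assumes n_eq: "n = q\<^sup>2 + 1"
    and u_Om: "i < n \<Longrightarrow> u i \<in> Om"
    and u_ratio: "i < n \<Longrightarrow> j < n \<Longrightarrow> i \<noteq> j \<Longrightarrow> u j / u i \<notin> k"
begin

lemma n_bounds: "10 \<le> n" "q + 1 < n"
proof -
  have "3 * 3 \<le> q * q" using q_gt2 by (intro mult_le_mono) auto
  then show "10 \<le> n" by (simp add: n_eq power2_eq_square)
  show "q + 1 < n" using q_powers by (simp add: n_eq)
qed

lemma u_nonzero: "i < n \<Longrightarrow> u i \<noteq> 0"
  using u_Om by (auto simp: Om_def)

lemma general_u:
  assumes "i1 < n" "i2 < n" "i3 < n" "i1 \<noteq> i2" "i1 \<noteq> i3" "i2 \<noteq> i3"
  shows "general (u i1) (u i2) (u i3)"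
  unfolding general_def using assms by (intro conjI u_Om u_ratio) simp_all

text \<open>The norm of \<open>x\<close> to \<open>K\<close> is \<open>x ^ n\<close>, and a nonzero
  element of \<open>k\<close> has \<open>(q - 1)\<close>-th power 1; hence \<open>Om\<close>
  consists of roots of unity of order dividing \<open>n * (q - 1)\<close>.\<close>

lemma card_Om_le: "card Om \<le> n * (q - 1)"
proof (rule card_roots_le_degree)
  let ?p = "monom 1 (n * (q - 1)) - 1 :: 'b poly"
  have pos: "0 < n * (q - 1)" using n_bounds q_gt2 by simp
  have "poly ?p 0 = - 1"
    using pos by (simp add: poly_monom zero_power)
  then show "?p \<noteq> 0" by auto
  show "degree ?p \<le> n * (q - 1)"
    by (rule degree_diff_le) (simp_all add: degree_monom_le)
  fix x assume x: "x \<in> Om"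
  define y where "y = x * \<phi> (\<phi> x)"
  have "y ^ q = y" "y \<noteq> 0"
    using x phi_eq by (simp_all add: Om_def k_def y_def)
  moreover have "y ^ q = y ^ (q - 1) * y"
    using q_gt2 power_minus_mult[of q y] by simp
  ultimately have "y ^ (q - 1) = 1" by simp
  moreover have "y = x ^ n" by (simp add: y_def phi2 n_eq)
  ultimately show "poly ?p x = 0" by (simp add: poly_monom power_mult)
qed

lemma inj_on_scale_u: "inj_on (\<lambda>(s, i). s * u i) ((k - {0}) \<times> {..<n})"
proof -
  have eqs: "s = t \<and> i = j" if s: "s \<in> k" "s \<noteq> 0" and t: "t \<in> k" "t \<noteq> 0"
    and ij: "i \<in> {..<n}" "j \<in> {..<n}" and eq: "s * u i = t * u j" for s t i j
  proof -
  have nz: "u i \<noteq> 0" "u j \<noteq> 0" using ij u_nonzero by auto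
  have "u j / u i = s / t"
    using eq nz t by (simp only: frac_eq_eq not_False_eq_True mult.commute)
  then have "u j / u i \<in> k" using k_closed(7) s t by simp
  then have "i = j" using u_ratio ij by blast
  moreover have "s = t" using eq nz \<open>i = j\<close> by simp
  ultimately show "s = t \<and> i = j" by blast
  qed
  show ?thesis
  proof (rule inj_onI)
    fix x y assume "x \<in> (k - {0}) \<times> {..<n}" "y \<in> (k - {0}) \<times> {..<n}"
      "(case x of (s, i) \<Rightarrow> s * u i) = (case y of (s, i) \<Rightarrow> s * u i)"
    then show "x = y"
      using eqs[of "fst x" "fst y" "snd x" "snd y"] by (auto simp: prod_eq_iff case_prod_beta)
  qed
qed

text \<open>The nonzero \<open>k\<close>-multiples of the representatives are distinct and already
  reach the upper bound \<open>n * (q - 1)\<close>.\<close>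

lemma Om_eq: "Om = (\<lambda>(s, i). s * u i) ` ((k - {0}) \<times> {..<n})"
proof (rule card_seteq[symmetric])
  show "(\<lambda>(s, i). s * u i) ` ((k - {0}) \<times> {..<n}) \<subseteq> Om"
  proof
    fix x assume "x \<in> (\<lambda>(s, i). s * u i) ` ((k - {0}) \<times> {..<n})"
    then obtain s i where s: "s \<in> k" "s \<noteq> 0" and i: "i < n" and x: "x = s * u i" by auto
    have "u i \<noteq> 0" "u i * \<phi> (\<phi> (u i)) \<in> k" using u_Om i by (auto simp: Om_def)
    moreover have "\<phi> s = s" using s by (simp add: k_def)
    then have "s * u i * \<phi> (\<phi> (s * u i)) = s * s * (u i * \<phi> (\<phi> (u i)))"
      by simp
    ultimately show "x \<in> Om"
      using s unfolding x Om_def by (metis (mono_tags) k_closed(6) mem_Collect_eq mult_eq_0_iff)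
  qed
  have "card (k - {0}) = q - 1" using card_k k_closed by simp
  then show "card Om \<le> card ((\<lambda>(s, i). s * u i) ` ((k - {0}) \<times> {..<n}))"
    using card_Om_le by (simp add: card_image[OF inj_on_scale_u] card_cartesian_product mult.commute)
qed simp

definition "word a c = (\<lambda>i. if i < n then L a c (u i) else 0)"

definition "code = (\<lambda>(a, c). word a c) ` UNIV"

definition "zset x = {i. i < n \<and> x i = (0 :: 'b)}"

lemma zset_subset: "zset x \<subseteq> {..<n}"
  by (auto simp: zset_def)

lemma finite_zset [simp]: "finite (zset x)"
  by (simp add: zset_def)

lemma zset_word: "zset (word a c) = {i. i < n \<and> L a c (u i) = 0}"
  by (auto simp: zset_def word_def)

text \<open>The kernel of the form is the span of the three points. It meets \<open>Om\<close> in
  \<open>(q + 1) * (q - 1)\<close> vectors, which are exactly the nonzero \<open>k\<close>-multiples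
  of the \<open>u i\<close> with \<open>i\<close> a zero of the word.\<close>

lemma kernel_word:
  assumes "i1 < n" "i2 < n" "i3 < n" "i1 \<noteq> i2" "i1 \<noteq> i3" "i2 \<noteq> i3" "(a, c) \<noteq> (0, 0)"
    and "L a c (u i1) = 0" "L a c (u i2) = 0" "L a c (u i3) = 0"
  shows "zset (word a c) = {i. i < n \<and> u i \<in> kspan (u i1) (u i2) (u i3)}"
    and "card (zset (word a c)) = q + 1"
proof -
  let ?S = "kspan (u i1) (u i2) (u i3)" and ?Z = "zset (word a c)"
  note g = general_u[OF assms(1-6)]
  note ker = L_kernel_eq_span[OF g assms(7-10)]
  show "?Z = {i. i < n \<and> u i \<in> ?S}"
    unfolding ker[symmetric] zset_word by simp
  have "Om \<inter> ?S = (\<lambda>(s, i). s * u i) ` ((k - {0}) \<times> ?Z)"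
  proof (intro equalityI subsetI)
    fix x assume x: "x \<in> Om \<inter> ?S"
    then obtain s i where si: "s \<in> k" "s \<noteq> 0" "i < n" "x = s * u i"
      unfolding Om_eq by auto
    have "L a c x = 0" using x ker by blast
    then have "i \<in> ?Z" using si by (simp add: zset_word L_scale)
    then show "x \<in> (\<lambda>(s, i). s * u i) ` ((k - {0}) \<times> ?Z)" using si by force
  next
    fix x assume "x \<in> (\<lambda>(s, i). s * u i) ` ((k - {0}) \<times> ?Z)"
    then obtain s i where si: "s \<in> k" "s \<noteq> 0" "i \<in> ?Z" "x = s * u i" by auto
    have "x \<in> Om" unfolding Om_eq using si zset_subset by force
    moreover have "L a c x = 0" using si by (simp add: L_scale zset_word)
    ultimately show "x \<in> Om \<inter> ?S" using ker by blast
  qed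
  moreover have "inj_on (\<lambda>(s, i). s * u i) ((k - {0}) \<times> ?Z)"
    by (rule inj_on_subset[OF inj_on_scale_u]) (use zset_subset in blast)
  moreover have "card (k - {0}) = q - 1" using card_k k_closed by simp
  ultimately have "(q - 1) * card ?Z = (q + 1) * (q - 1)"
    using card_Om_span[OF g] by (simp add: card_image card_cartesian_product)
  then have "card ?Z * (q - 1) = (q + 1) * (q - 1)" by (simp only: mult.commute)
  then show "card ?Z = q + 1" using q_gt2 unfolding mult_cancel2 by simp
qed

section \<open>Counting words with prescribed zeros\<close>

definition "V X = {(a, c). \<forall>x\<in>X. L a c x = 0}"

text \<open>Evaluation at \<open>x\<close> is additive with values in \<open>K\<close>, so one more
  condition divides the count by at most \<open>q\<^sup>2\<close>.\<close>

lemma card_V_le: "card (V X) \<le> card (V (insert x X)) * q\<^sup>2"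
proof -
  have "card (V X) \<le> card {p \<in> V X. (\<lambda>(a, c). L a c x) p = 0} * card K"
    by (rule card_le_kernel_times_image) (auto simp: V_def L_diff_coeffs L_in_K)
  also have "{p \<in> V X. (\<lambda>(a, c). L a c x) p = 0} = V (insert x X)"
    by (auto simp: V_def)
  finally show ?thesis by (simp add: card_K)
qed

lemma V_trivial:
  assumes "general u1 u2 u3" "y \<notin> kspan u1 u2 u3"
  shows "V {y, u1, u2, u3} = {(0, 0)}"
proof -
  have "p \<in> V {y, u1, u2, u3} \<longleftrightarrow> p = (0, 0)" for p
  proof
    assume p: "p \<in> V {y, u1, u2, u3}"
    obtain a c where ac: "p = (a, c)" by (cases p)
    have *: "L a c y = 0" "L a c u1 = 0" "L a c u2 = 0" "L a c u3 = 0"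
      using p by (auto simp: V_def ac)
    show "p = (0, 0)"
      using L_kernel_eq_span[OF assms(1) _ *(2-4)] *(1) assms(2) ac by blast
  qed (auto simp: V_def L_def)
  then show ?thesis by blast
qed

text \<open>There are \<open>q ^ 8\<close> forms, and vanishing at \<open>u1\<close>,
  \<open>u2\<close>, \<open>u3\<close> and a point \<open>y\<close> off their span leaves one. Each
  of the four conditions divides by at most \<open>q\<^sup>2\<close>, so each divides by exactly
  \<open>q\<^sup>2\<close>.\<close>

lemma card_V:
  assumes "general u1 u2 u3"
  shows "card (V {u1}) = q ^ 6" "card (V {u2, u1}) = q ^ 4" "card (V {u3, u2, u1}) = q ^ 2"
proof -
  have "card (kspan u1 u2 u3) \<noteq> card (UNIV :: 'b set)"
    using card_span[OF assms] card_field q_powers by simp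
  then have "kspan u1 u2 u3 \<noteq> UNIV" by metis
  then obtain y where y: "y \<notin> kspan u1 u2 u3" by blast
  have "V {y, u3, u2, u1} = {(0, 0)}"
    using V_trivial[OF assms y] by (simp add: insert_commute)
  then have 4: "card (V {u3, u2, u1}) \<le> q\<^sup>2"
    using card_V_le[of "{u3, u2, u1}" y] by simp
  have 0: "card (V {}) = q ^ 8"
    using card_field by (simp add: V_def UNIV_Times_UNIV[symmetric] card_cartesian_product del: UNIV_Times_UNIV)
  have 1: "q ^ 8 \<le> card (V {u1}) * q\<^sup>2"
    using card_V_le[of "{}" u1] by (simp add: 0)
  have 2: "card (V {u1}) \<le> card (V {u2, u1}) * q\<^sup>2" and 3: "card (V {u2, u1}) \<le> card (V {u3, u2, u1}) * q\<^sup>2"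
    using card_V_le by blast+
  have pw: "q ^ 8 = q ^ 6 * q\<^sup>2" "q ^ 6 = q ^ 4 * q\<^sup>2" "q ^ 4 = q\<^sup>2 * q\<^sup>2"
    by (simp_all flip: power_add)
  have pos: "0 < q\<^sup>2" using q_gt2 by simp
  have up3: "card (V {u2, u1}) \<le> q ^ 4"
    unfolding pw using 3 4 by (meson mult_le_mono1 order_trans)
  have up2: "card (V {u1}) \<le> q ^ 6"
    unfolding pw(2) using 2 up3 by (meson mult_le_mono1 order_trans)
  have lo1: "q ^ 6 \<le> card (V {u1})"
    using 1 unfolding pw(1) by (rule mult_right_le_imp_le) (rule pos)
  then have "q ^ 4 * q\<^sup>2 \<le> card (V {u2, u1}) * q\<^sup>2"
    unfolding pw(2)[symmetric] using 2 by (rule order_trans)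
  then have lo2: "q ^ 4 \<le> card (V {u2, u1})"
    by (rule mult_right_le_imp_le) (rule pos)
  then have "q\<^sup>2 * q\<^sup>2 \<le> card (V {u3, u2, u1}) * q\<^sup>2"
    unfolding pw(3)[symmetric] using 3 by (rule order_trans)
  then have lo3: "q\<^sup>2 \<le> card (V {u3, u2, u1})"
    by (rule mult_right_le_imp_le) (rule pos)
  show "card (V {u1}) = q ^ 6" "card (V {u2, u1}) = q ^ 4" "card (V {u3, u2, u1}) = q ^ 2"
    using up2 lo1 up3 lo2 4 lo3 by (simp_all only: order_antisym)
qed

text \<open>A nonzero form vanishing at all \<open>n\<close> points vanishes at three of them, so
  \<open>kernel_word\<close> allows it only \<open>q + 1 < n\<close> zeros.\<close>

lemma word_eq_0_iff: "word a c = (\<lambda>_. 0) \<longleftrightarrow> a = 0 \<and> c = 0"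
proof
  assume w: "word a c = (\<lambda>_. 0)"
  show "a = 0 \<and> c = 0"
  proof (rule ccontr)
    assume "\<not> (a = 0 \<and> c = 0)"
    then have nz: "(a, c) \<noteq> (0, 0)" by simp
    have z: "L a c (u i) = 0" if "i < n" for i
      using fun_cong[OF w, of i] that by (simp add: word_def)
    have "card (zset (word a c)) = q + 1"
      by (rule kernel_word(2)[of 0 1 2]) (use n_bounds nz z in auto)
    moreover have "zset (word a c) = {..<n}" by (auto simp: zset_word z)
    ultimately show False using n_bounds by simp
  qed
qed (auto simp: word_def L_def)

lemma inj_word: "inj (\<lambda>(a, c). word a c)"
proof -
  have eqs: "a = a' \<and> c = c'" if "word a c = word a' c'" for a c a' c'
  proof -
    have "L a c (u i) = L a' c' (u i)" if "i < n" for i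
      using fun_cong[OF \<open>word a c = word a' c'\<close>, of i] that by (simp add: word_def)
    then have "word (a - a') (c - c') = (\<lambda>_. 0)"
      by (simp add: word_def L_diff_coeffs fun_eq_iff)
    then show ?thesis by (simp add: word_eq_0_iff)
  qed
  show ?thesis
    by (rule injI) (metis (no_types, lifting) eqs case_prod_beta prod_eq_iff)
qed

lemma finite_code [simp]: "finite code"
  by (simp add: code_def)

lemma card_vanishing:
  assumes T: "T \<subseteq> {..<n}" "card T \<le> 3"
  shows "card {x \<in> code. T \<subseteq> zset x} = q ^ (8 - 2 * card T)"
proof -
  have "V (u ` T) = {p. T \<subseteq> zset ((\<lambda>(a, c). word a c) p)}"
    using T by (auto simp: V_def zset_word)
  then have "{x \<in> code. T \<subseteq> zset x} = (\<lambda>(a, c). word a c) ` V (u ` T)"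
    unfolding code_def by blast
  then have eq: "card {x \<in> code. T \<subseteq> zset x} = card (V (u ` T))"
    by (simp add: card_image inj_on_subset[OF inj_word])
  \<comment> \<open>\<open>card_V\<close> speaks of three points in general position, so smaller
    sets are completed to three.\<close>
  obtain T' where T': "T \<subseteq> T'" "T' \<subseteq> {..<n}" "card T' = 3"
    using exists_subset_between[of T 3 "{..<n}"] T n_bounds by auto
  have finT: "finite T" using T(1) finite_subset by blast
  consider "card T = 0" | "card T = 1" | "card T = 2" | "card T = 3"
    using T(2) by linarith
  then show ?thesis
  proof cases
    case 1
    then have "T = {}" using finT by simp
    then show ?thesis using card_field eq
      by (simp add: V_def UNIV_Times_UNIV[symmetric] card_cartesian_product flip: power_add del: UNIV_Times_UNIV)
  next
    case 2
    then obtain i1 where i1: "T = {i1}" by (auto simp: card_1_singleton_iff)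
    have "card (T' - T) = 2" using T' 2 finT by (simp add: card_Diff_subset)
    then obtain i2 i3 where "T' - T = {i2, i3}" "i2 \<noteq> i3" by (auto simp: card_2_iff)
    then have "i1 < n" "i2 < n" "i3 < n" "i1 \<noteq> i2" "i1 \<noteq> i3" "i2 \<noteq> i3" using T' i1 by auto
    from card_V(1)[OF general_u[OF this]] show ?thesis using eq 2 i1 by simp
  next
    case 3
    then obtain i1 i2 where i12: "T = {i1, i2}" "i1 \<noteq> i2" by (auto simp: card_2_iff)
    have "card (T' - T) = 1" using T' 3 finT by (simp add: card_Diff_subset)
    then obtain i3 where "T' - T = {i3}" by (auto simp: card_1_singleton_iff)
    then have "i2 < n" "i1 < n" "i3 < n" "i2 \<noteq> i1" "i2 \<noteq> i3" "i1 \<noteq> i3" using T' i12 by auto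
    from card_V(2)[OF general_u[OF this]] show ?thesis using eq 3 i12 by simp
  next
    case 4
    then obtain i1 i2 i3 where i: "T = {i1, i2, i3}" "i1 \<noteq> i2" "i1 \<noteq> i3" "i2 \<noteq> i3"
      by (auto simp: card_3_iff)
    then have "i3 < n" "i2 < n" "i1 < n" "i3 \<noteq> i2" "i3 \<noteq> i1" "i2 \<noteq> i1" using T by auto
    from card_V(3)[OF general_u[OF this]] show ?thesis using eq 4 i by simp
  qed
qed

lemma card_code: "card code = q ^ 8"
  using card_vanishing[of "{}"] by simp

lemma code_zero: "(\<lambda>_. 0) \<in> code"
  using word_eq_0_iff[of 0 0] by (auto simp: code_def image_iff intro!: exI[of _ 0])

lemma code_add: "x \<in> code \<Longrightarrow> y \<in> code \<Longrightarrow> (\<lambda>i. x i + y i) \<in> code"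
proof -
  assume "x \<in> code" "y \<in> code"
  then obtain a c a' c' where "x = word a c" "y = word a' c'" by (auto simp: code_def)
  then have "(\<lambda>i. x i + y i) = word (a + a') (c + c')"
    by (auto simp: word_def L_def algebra_simps fun_eq_iff)
  then show ?thesis by (auto simp: code_def)
qed

lemma code_scale: "s \<in> K \<Longrightarrow> x \<in> code \<Longrightarrow> (\<lambda>i. s * x i) \<in> code"
proof -
  assume s: "s \<in> K" and "x \<in> code"
  then obtain a c where "x = word a c" by (auto simp: code_def)
  then have "(\<lambda>i. s * x i) = word (s * a) (s * c)"
    using s by (auto simp: word_def L_scale_coeffs fun_eq_iff)
  then show ?thesis by (auto simp: code_def)
qed

lemma code_vecs: "code \<subseteq> vecs K n"
  by (auto simp: code_def word_def vecs_def L_in_K)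

lemma card_zset_secant:
  assumes "x \<in> code" "x \<noteq> (\<lambda>_. 0)" "3 \<le> card (zset x)"
  shows "card (zset x) = q + 1"
proof -
  obtain a c where ac: "x = word a c" using assms(1) by (auto simp: code_def)
  obtain T where T: "T \<subseteq> zset x" "card T = 3"
    using obtain_subset_with_card_n[OF assms(3)] by auto
  then obtain i1 i2 i3 where i: "T = {i1, i2, i3}" "i1 \<noteq> i2" "i1 \<noteq> i3" "i2 \<noteq> i3"
    by (auto simp: card_3_iff)
  show ?thesis unfolding ac
    by (rule kernel_word(2)[of i1 i2 i3]) (use i T ac assms(2) in \<open>auto simp: zset_word word_eq_0_iff\<close>)
qed

text \<open>Both zero sets consist of the points in the plane spanned by the three points of
  \<open>T\<close>.\<close>

lemma zset_unique:
  assumes "x \<in> code" "x \<noteq> (\<lambda>_. 0)" "y \<in> code" "y \<noteq> (\<lambda>_. 0)"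
    and T: "T \<subseteq> zset x" "T \<subseteq> zset y" "card T = 3"
  shows "zset x = zset y"
proof -
  obtain a c a' c' where ac: "x = word a c" "y = word a' c'" using assms by (auto simp: code_def)
  obtain i1 i2 i3 where i: "T = {i1, i2, i3}" "i1 \<noteq> i2" "i1 \<noteq> i3" "i2 \<noteq> i3"
    using T(3) by (auto simp: card_3_iff)
  have "zset x = {i. i < n \<and> u i \<in> kspan (u i1) (u i2) (u i3)}" unfolding ac
    by (rule kernel_word(1)) (use i T ac assms(2) in \<open>auto simp: zset_word word_eq_0_iff\<close>)
  moreover have "zset y = {i. i < n \<and> u i \<in> kspan (u i1) (u i2) (u i3)}" unfolding ac
    by (rule kernel_word(1)) (use i T ac assms(4) in \<open>auto simp: zset_word word_eq_0_iff\<close>)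
  ultimately show ?thesis by simp
qed

text \<open>A point in the plane of three others is a \<open>k\<close>-combination of them, and
  every form is \<open>k\<close>-linear, so one relation serves all codewords. It supplies the dual
  words of weight 4.\<close>

lemma zset_dependent:
  assumes "x \<in> code" "x \<noteq> (\<lambda>_. 0)" "{i, i1, i2, i3} \<subseteq> zset x" "i1 \<noteq> i2" "i1 \<noteq> i3" "i2 \<noteq> i3"
  obtains x1 x2 x3 where "x1 \<in> K" "x2 \<in> K" "x3 \<in> K"
    "\<And>y. y \<in> code \<Longrightarrow> y i = x1 * y i1 + x2 * y i2 + x3 * y i3"
proof -
  obtain a c where ac: "x = word a c" using assms by (auto simp: code_def)
  have lt: "i < n" "i1 < n" "i2 < n" "i3 < n" using assms(3) zset_subset by blast+
  have "zset x = {i. i < n \<and> u i \<in> kspan (u i1) (u i2) (u i3)}" unfolding ac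
    by (rule kernel_word(1)) (use ac assms in \<open>auto simp: zset_word word_eq_0_iff\<close>)
  then have "u i \<in> kspan (u i1) (u i2) (u i3)" using assms(3) by auto
  then obtain x1 x2 x3 where x: "x1 \<in> k" "x2 \<in> k" "x3 \<in> k" "u i = x1 * u i1 + x2 * u i2 + x3 * u i3"
    by (auto simp: kspan_def)
  show ?thesis
  proof
    show "x1 \<in> K" "x2 \<in> K" "x3 \<in> K" using x k_subset_K by auto
    fix y assume "y \<in> code"
    then obtain a' c' where "y = word a' c'" by (auto simp: code_def)
    then show "y i = x1 * y i1 + x2 * y i2 + x3 * y i3"
      using lt x(1-3) by (simp add: word_def x(4) L_add L_scale)
  qed
qed

end

section \<open>Steiner systems\<close>

lemma two_choose: "2 * int (x choose 2) = int x * (int x - 1)"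
  by (induction x) (auto simp: numeral_2_eq_2 algebra_simps)

lemma six_choose: "6 * int (x choose 3) = int x * (int x - 1) * (int x - 2)"
proof (induction x)
  case (Suc x)
  have "Suc x choose 3 = (x choose 2) + (x choose 3)"
    by (simp add: numeral_3_eq_3 numeral_2_eq_2)
  then have "6 * int (Suc x choose 3) = 3 * (2 * int (x choose 2)) + 6 * int (x choose 3)"
    by simp
  also have "\<dots> = int (Suc x) * (int (Suc x) - 1) * (int (Suc x) - 2)"
    unfolding Suc two_choose by (simp add: algebra_simps)
  finally show ?case .
qed simp

text \<open>Pairs of an element \<open>x\<close> and a \<open>t\<close>-subset of \<open>Z x\<close>
  are counted in two ways. This gives both the power moments and the block counts.\<close>

lemma double_count_subsets:
  assumes "finite A" "finite Y" "\<And>x. x \<in> A \<Longrightarrow> Z x \<subseteq> Y"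
    and "\<And>T. T \<subseteq> Y \<Longrightarrow> card T = t \<Longrightarrow> card {x \<in> A. T \<subseteq> Z x} = N"
  shows "(\<Sum>x\<in>A. card (Z x) choose t) = N * (card Y choose t)"
proof -
  let ?S = "{T. T \<subseteq> Y \<and> card T = t}"
  have "(\<Sum>x\<in>A. card (Z x) choose t) = (\<Sum>x\<in>A. card {T \<in> ?S. T \<subseteq> Z x})"
  proof (rule sum.cong[OF refl])
    fix x assume x: "x \<in> A"
    have "{T \<in> ?S. T \<subseteq> Z x} = {T. T \<subseteq> Z x \<and> card T = t}" using assms(3)[OF x] by blast
    moreover have "finite (Z x)" using assms(2,3) x finite_subset by blast
    ultimately show "card (Z x) choose t = card {T \<in> ?S. T \<subseteq> Z x}" by (simp add: n_subsets)
  qed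
  also have "\<dots> = N * card ?S"
    by (rule sum_multicount) (use assms in auto)
  also have "card ?S = card Y choose t" by (rule n_subsets[OF assms(2)])
  finally show ?thesis .
qed

text \<open>Double counting of the sets \<open>T\<close> disjoint from \<open>X\<close> that
  complete it to \<open>t\<close> points: each \<open>T \<union> X\<close> lies in exactly one
  block.\<close>

lemma steiner_blocks_through:
  assumes V: "finite Y" and B: "\<And>b. b \<in> B \<Longrightarrow> b \<subseteq> Y \<and> card b = \<kappa>"
    and S: "\<And>T. T \<subseteq> Y \<Longrightarrow> card T = t \<Longrightarrow> card {b \<in> B. T \<subseteq> b} = 1"
    and X: "X \<subseteq> Y" "card X \<le> t"
  shows "card {b \<in> B. X \<subseteq> b} * ((\<kappa> - card X) choose (t - card X)) = (card Y - card X) choose (t - card X)"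
proof -
  have finX: "finite X" using V X finite_subset by blast
  have finB: "finite B" using B V by (meson Pow_iff finite_Pow_iff finite_subset subsetI)
  have "(\<Sum>b\<in>{b \<in> B. X \<subseteq> b}. card (b - X) choose (t - card X)) = 1 * (card (Y - X) choose (t - card X))"
  proof (rule double_count_subsets)
    fix T assume T: "T \<subseteq> Y - X" "card T = t - card X"
    then have "card (T \<union> X) = t"
      using finX V X(2) by (subst card_Un_disjoint) (auto intro: finite_subset)
    then have "card {b \<in> B. T \<union> X \<subseteq> b} = 1" using S[of "T \<union> X"] T X by blast
    moreover have "{b \<in> {b \<in> B. X \<subseteq> b}. T \<subseteq> b - X} = {b \<in> B. T \<union> X \<subseteq> b}" using T by blast
    ultimately show "card {b \<in> {b \<in> B. X \<subseteq> b}. T \<subseteq> b - X} = 1" by simp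
  qed (use V B finB in auto)
  also have "(\<Sum>b\<in>{b \<in> B. X \<subseteq> b}. card (b - X) choose (t - card X)) =
    (\<Sum>b\<in>{b \<in> B. X \<subseteq> b}. (\<kappa> - card X) choose (t - card X))"
    by (rule sum.cong) (use B finX in \<open>auto simp: card_Diff_subset\<close>)
  finally show ?thesis using X finX by (simp add: card_Diff_subset)
qed

text \<open>In a Steiner system \<open>3-(q\<^sup>2+1, q+1, 1)\<close>, the number of blocks avoiding three points follows
  by inclusion-exclusion from the numbers \<open>q(q\<^sup>2+1)\<close>, \<open>q(q+1)\<close>, \<open>q+1\<close>, \<open>1\<close> of blocks through
  zero, one, two and three points.\<close>

lemma inversive_plane_blocks_avoiding:
  fixes q :: nat
  assumes V: "finite Y" "card Y = q\<^sup>2 + 1" and q: "2 \<le> q"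
    and B: "\<And>b. b \<in> B \<Longrightarrow> b \<subseteq> Y \<and> card b = q + 1"
    and S: "\<And>T. T \<subseteq> Y \<Longrightarrow> card T = 3 \<Longrightarrow> card {b \<in> B. T \<subseteq> b} = 1"
    and T: "T \<subseteq> Y" "card T = 3"
  shows "card {b \<in> B. b \<inter> T = {}} = (q\<^sup>2 - q - 1) * (q - 2)"
proof -
  define N where "N X = card {b \<in> B. X \<subseteq> b}" for X
  define Q where "Q = int q"
  have Q: "2 \<le> Q" using q by (simp add: Q_def)
  have finB: "finite B" using B V by (meson Pow_iff finite_Pow_iff finite_subset subsetI)
  have through: "N X * ((q + 1 - card X) choose (3 - card X)) = (card Y - card X) choose (3 - card X)"
    if "X \<subseteq> Y" "card X \<le> 3" for X
    unfolding N_def by (rule steiner_blocks_through) (use V B S that in blast)+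
  have N0: "int (N {}) = Q * (Q\<^sup>2 + 1)"
  proof -
    have "int (N {}) * (6 * int ((q + 1) choose 3)) = 6 * int ((q\<^sup>2 + 1) choose 3)"
      using through[where X = "{}"] V by (simp flip: of_nat_mult)
    then have "int (N {}) * ((Q + 1) * Q * (Q - 1)) = (Q\<^sup>2 + 1) * Q\<^sup>2 * (Q\<^sup>2 - 1)"
      unfolding six_choose by (simp add: Q_def add.commute)
    also have "\<dots> = Q * (Q\<^sup>2 + 1) * ((Q + 1) * Q * (Q - 1))"
      by (simp add: power2_eq_square algebra_simps)
    finally show ?thesis using Q by simp
  qed
  have N1: "int (N {x}) = Q * (Q + 1)" if "x \<in> Y" for x
  proof -
    have "int (N {x}) * (2 * int (q choose 2)) = 2 * int (q\<^sup>2 choose 2)"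
      using through[where X = "{x}"] V that by (simp flip: of_nat_mult)
    then have "int (N {x}) * (Q * (Q - 1)) = Q\<^sup>2 * (Q\<^sup>2 - 1)"
      unfolding two_choose by (simp add: Q_def)
    also have "\<dots> = Q * (Q + 1) * (Q * (Q - 1))"
      by (simp add: power2_eq_square algebra_simps)
    finally show ?thesis using Q by simp
  qed
  have N2: "int (N {x, y}) = Q + 1" if "x \<in> Y" "y \<in> Y" "x \<noteq> y" for x y
  proof -
    have q2: "1 \<le> q\<^sup>2" using q by simp
    have "N {x, y} * (q - 1) = q\<^sup>2 - 1"
      using through[where X = "{x, y}"] V that by (simp add: numeral_2_eq_2)
    then have "int (N {x, y}) * int (q - 1) = int (q\<^sup>2 - 1)" by (simp flip: of_nat_mult)
    then have "int (N {x, y}) * (Q - 1) = Q\<^sup>2 - 1"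
      using q q2 by (simp add: Q_def of_nat_diff)
    also have "\<dots> = (Q + 1) * (Q - 1)"
      by (simp add: power2_eq_square algebra_simps)
    finally show ?thesis using Q by simp
  qed
  obtain x y z where xyz: "T = {x, y, z}" "x \<noteq> y" "x \<noteq> z" "y \<noteq> z"
    using T(2) by (auto simp: card_3_iff)
  then have mem: "x \<in> Y" "y \<in> Y" "z \<in> Y" using T(1) by auto
  define P where "P w = {b \<in> B. w \<in> b}" for w
  have fin: "finite (P w)" for w using finB by (simp add: P_def)
  have c1: "int (card (P w)) = Q * (Q + 1)" if "w \<in> Y" for w
    using N1[OF that] by (simp add: N_def P_def)
  have c2: "int (card (P v \<inter> P w)) = Q + 1" if "v \<in> Y" "w \<in> Y" "v \<noteq> w" for v w
  proof -
    have "P v \<inter> P w = {b \<in> B. {v, w} \<subseteq> b}" by (auto simp: P_def)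
    then show ?thesis using N2[OF that] by (simp only: N_def)
  qed
  have c3: "card (P x \<inter> P y \<inter> P z) = 1"
  proof -
    have "P x \<inter> P y \<inter> P z = {b \<in> B. T \<subseteq> b}" by (auto simp: P_def xyz)
    then show ?thesis using S[OF T] by simp
  qed
  have u1: "card (P x) + card (P y) = card (P x \<union> P y) + card (P x \<inter> P y)"
    by (rule card_Un_Int[OF fin fin])
  have u2: "card (P x \<union> P y) + card (P z) = card (P x \<union> P y \<union> P z) + card ((P x \<union> P y) \<inter> P z)"
    using fin by (intro card_Un_Int) auto
  have u3: "card (P x \<inter> P z) + card (P y \<inter> P z) = card ((P x \<inter> P z) \<union> (P y \<inter> P z)) + card ((P x \<inter> P z) \<inter> (P y \<inter> P z))"
    using fin by (intro card_Un_Int) auto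
  have e1: "(P x \<inter> P z) \<union> (P y \<inter> P z) = (P x \<union> P y) \<inter> P z"
    and e2: "(P x \<inter> P z) \<inter> (P y \<inter> P z) = P x \<inter> P y \<inter> P z" by auto
  \<comment> \<open>Inclusion-exclusion for three sets; keeping their common size as a variable
    \<open>M\<close> leaves a linear problem.\<close>
  have un: "int (card (P x \<union> P y \<union> P z)) = 3 * M - 3 * (Q + 1) + 1"
    if "\<And>w. w \<in> Y \<Longrightarrow> int (card (P w)) = M" for M
    using arg_cong[OF u1, of int] arg_cong[OF u2, of int] arg_cong[OF u3, of int]
      that[OF mem(1)] that[OF mem(2)] that[OF mem(3)] arg_cong[OF c3, of int]
      c2[OF mem(1,2) xyz(2)] c2[OF mem(1,3) xyz(3)] c2[OF mem(2,3) xyz(4)]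
    unfolding e1 e2 of_nat_add of_nat_1 by algebra
  have "{b \<in> B. b \<inter> T = {}} = B - (P x \<union> P y \<union> P z)"
    by (auto simp: P_def xyz)
  then have "card {b \<in> B. b \<inter> T = {}} = card B - card (P x \<union> P y \<union> P z)"
    by (simp add: card_Diff_subset fin, subst card_Diff_subset) (auto simp: fin P_def finB)
  moreover have "card (P x \<union> P y \<union> P z) \<le> card B"
    by (rule card_mono[OF finB]) (auto simp: P_def)
  ultimately have "int (card {b \<in> B. b \<inter> T = {}}) = Q * (Q\<^sup>2 + 1) - (3 * (Q * (Q + 1)) - 3 * (Q + 1) + 1)"
    using N0 un[OF c1] by (simp add: N_def of_nat_diff)
  also have "\<dots> = (Q\<^sup>2 - Q - 1) * (Q - 2)"
    by (simp add: power2_eq_square algebra_simps)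
  also have "\<dots> = int ((q\<^sup>2 - q - 1) * (q - 2))"
  proof -
    \<comment> \<open>This makes the truncated subtraction in \<open>q\<^sup>2 - q - 1\<close>
      exact.\<close>
    have "q + 1 \<le> q\<^sup>2"
    proof -
      have "2 * q \<le> q * q" using q by (intro mult_le_mono1)
      then show ?thesis using q unfolding power2_eq_square by linarith
    qed
    then show ?thesis using q by (simp add: Q_def of_nat_diff)
  qed
  finally show ?thesis by linarith
qed

section \<open>Weight distribution\<close>

context ovoid
begin

lemma zset_eq_full_iff:
  assumes "x \<in> code"
  shows "card (zset x) = n \<longleftrightarrow> x = (\<lambda>_. 0)"
proof
  assume "card (zset x) = n"
  then show "x = (\<lambda>_. 0)"
    using card_zset_secant[OF assms] n_bounds by fastforce
qed (simp add: zset_def)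

lemma hweight_eq: "hweight n x = n - card (zset x)"
proof -
  have "{i. i < n \<and> x i \<noteq> 0} = {..<n} - zset x" by (auto simp: zset_def)
  then show ?thesis
    unfolding hweight_def by (simp add: card_Diff_subset zset_subset)
qed

lemma supp_eq: "supp n x = {..<n} - zset x"
  by (auto simp: supp_def zset_def)

lemma card_zset_le: "card (zset x) \<le> n"
  using card_mono[OF _ zset_subset, of x] by simp

text \<open>Indexed by the number of zeros, so that \<open>A j\<close> is the number of words of
  weight \<open>n - j\<close>.\<close>

definition "A j = card {x \<in> code. card (zset x) = j}"

lemma card_zset_cases:
  assumes "x \<in> code"
  shows "card (zset x) \<in> {0, 1, 2, q + 1, n}"
proof (cases "x = (\<lambda>_. 0)")
  case True
  then show ?thesis using zset_eq_full_iff[OF assms] by simp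
next
  case False
  show ?thesis
  proof (cases "3 \<le> card (zset x)")
    case True
    then show ?thesis using card_zset_secant[OF assms False] by simp
  next
    case False
    then have "card (zset x) = 0 \<or> card (zset x) = 1 \<or> card (zset x) = 2" by linarith
    then show ?thesis by blast
  qed
qed

lemma A_n: "A n = 1"
proof -
  have "{x \<in> code. card (zset x) = n} = {\<lambda>_. 0}"
    using zset_eq_full_iff code_zero by auto
  then show ?thesis by (simp add: A_def)
qed

lemma A_eq_0:
  assumes "j \<notin> {0, 1, 2, q + 1, n}"
  shows "A j = 0"
proof -
  have "{x \<in> code. card (zset x) = j} = {}"
  proof (intro equals0I, elim CollectE conjE)
    fix x assume x: "x \<in> code" "card (zset x) = j"
    show False using card_zset_cases[OF x(1)] assms unfolding x(2) by (rule notE[rotated])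
  qed
  then show ?thesis by (simp only: A_def card.empty)
qed

lemma sum_zset:
  fixes f :: "nat \<Rightarrow> nat"
  shows "(\<Sum>x\<in>code. f (card (zset x))) = A 0 * f 0 + A 1 * f 1 + A 2 * f 2 + A (q + 1) * f (q + 1) + f n"
proof -
  let ?J = "{0, 1, 2, q + 1, n}"
  have J: "(\<lambda>x. card (zset x)) ` code \<subseteq> ?J" by (rule image_subsetI) (rule card_zset_cases)
  have "(\<Sum>x\<in>code. f (card (zset x))) = (\<Sum>j\<in>?J. \<Sum>x\<in>{x \<in> code. card (zset x) = j}. f (card (zset x)))"
    by (rule sum.group[OF _ _ J, symmetric]) simp_all
  also have "\<dots> = (\<Sum>j\<in>?J. A j * f j)"
    by (rule sum.cong) (simp_all add: A_def)
  also have "\<dots> = A 0 * f 0 + A 1 * f 1 + A 2 * f 2 + A (q + 1) * f (q + 1) + f n"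
    using q_gt2 n_bounds A_n by simp
  finally show ?thesis .
qed

text \<open>Counts pairs of a codeword and a \<open>t\<close>-set of its zeros. The separate summand
  \<open>n choose t\<close> comes from the zero word.\<close>

lemma moment:
  assumes "t \<le> 3"
  shows "A 0 * (0 choose t) + A 1 * (1 choose t) + A 2 * (2 choose t) + A (q + 1) * ((q + 1) choose t)
    + (n choose t) = q ^ (8 - 2 * t) * (n choose t)"
proof -
  have "(\<Sum>x\<in>code. card (zset x) choose t) = q ^ (8 - 2 * t) * (card {..<n} choose t)"
    by (rule double_count_subsets) (use assms zset_subset card_vanishing in auto)
  then show ?thesis using sum_zset[of "\<lambda>j. j choose t"] by simp
qed

text \<open>The moments form a triangular system, solved downwards from \<open>t = 3\<close>, where
  only \<open>A (q + 1)\<close> and the zero word contribute. Factors 6 and 2 clear the binomials;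
  the final halves are exact, since twice the unknown has been computed.\<close>

lemma A_values:
  defines "Q \<equiv> int q"
  shows "int (A (q + 1)) = Q ^ 5 - Q"
    and "int (A 2) = (Q ^ 4 - 1) * (Q - 1) * Q ^ 3 div 2"
    and "int (A 1) = Q ^ 7 - Q ^ 5 + Q ^ 4 - Q ^ 3 + Q - 1"
    and "int (A 0) = (Q ^ 4 - 1) * (Q - 1) * Q ^ 3 div 2"
proof -
  have Q: "3 \<le> Q" using q_gt2 by (simp add: Q_def)
  have n: "int n = Q\<^sup>2 + 1" by (simp add: n_eq Q_def)
  have m3: "int (A (q + 1)) * (6 * int ((q + 1) choose 3)) + 6 * int (n choose 3) = Q\<^sup>2 * (6 * int (n choose 3))"
    using arg_cong[OF moment[of 3], of "\<lambda>x. 6 * int x"]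
    by (simp add: Q_def binomial_eq_0 algebra_simps)
  have "int (A (q + 1)) * ((Q + 1) * Q * (Q - 1)) = (Q ^ 5 - Q) * ((Q + 1) * Q * (Q - 1))"
    using m3 unfolding six_choose n by (simp add: Q_def[symmetric] eval_nat_numeral algebra_simps)
  then show B: "int (A (q + 1)) = Q ^ 5 - Q" using Q by simp
  have m2: "2 * int (A 2) + int (A (q + 1)) * (2 * int ((q + 1) choose 2)) + 2 * int (n choose 2) = Q ^ 4 * (2 * int (n choose 2))"
    using arg_cong[OF moment[of 2], of "\<lambda>x. 2 * int x"] by (simp add: Q_def binomial_eq_0 algebra_simps)
  have A2: "2 * int (A 2) = (Q ^ 4 - 1) * (Q - 1) * Q ^ 3"
    using m2 unfolding two_choose n B by (simp add: Q_def[symmetric] eval_nat_numeral algebra_simps)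
  then show "int (A 2) = (Q ^ 4 - 1) * (Q - 1) * Q ^ 3 div 2" by presburger
  have m1: "int (A 1) + 2 * int (A 2) + int (A (q + 1)) * (Q + 1) + int n = Q ^ 6 * int n"
    using arg_cong[OF moment[of 1], of int] by (simp add: Q_def algebra_simps)
  show A1: "int (A 1) = Q ^ 7 - Q ^ 5 + Q ^ 4 - Q ^ 3 + Q - 1"
    using m1 unfolding A2 n B by (simp add: eval_nat_numeral algebra_simps)
  have m0: "int (A 0) + int (A 1) + int (A 2) + int (A (q + 1)) + 1 = Q ^ 8"
    using arg_cong[OF moment[of 0], of int] by (simp add: Q_def algebra_simps)
  have "2 * int (A 0) = 2 * Q ^ 8 - 2 * int (A 1) - 2 * int (A 2) - 2 * int (A (q + 1)) - 2"
    using m0 by simp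
  also have "\<dots> = (Q ^ 4 - 1) * (Q - 1) * Q ^ 3"
    unfolding A2 A1 B by (simp add: eval_nat_numeral algebra_simps)
  finally show "int (A 0) = (Q ^ 4 - 1) * (Q - 1) * Q ^ 3 div 2" by presburger
qed

lemma weight_enum_code:
  defines "Q \<equiv> int q"
  shows "weight_enum n code =
          1 + monom (Q^5 - Q) (q^2 - q)
            + monom ((Q^4 - 1) * (Q - 1) * Q^3 div 2) (q^2 - 1)
            + monom ((Q^4 - 1) * (Q - 1) * Q^3 div 2) (q^2 + 1)
            + monom (Q^7 - Q^5 + Q^4 - Q^3 + Q - 1) (q^2)"
proof -
  let ?J = "{0, 1, 2, q + 1, n}"
  have "weight_enum n code = (\<Sum>i\<le>n. monom (int (A (n - i))) i)"
    unfolding weight_enum_def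
  proof (rule sum.cong[OF refl])
    fix i assume "i \<in> {..n}"
    then have "hweight n x = i \<longleftrightarrow> card (zset x) = n - i" for x
      using card_zset_le[of x] by (auto simp: hweight_eq)
    then show "monom (int (card {c \<in> code. hweight n c = i})) i = monom (int (A (n - i))) i"
      by (simp add: A_def)
  qed
  \<comment> \<open>Reindexed by the number of zeros, the sum has nonzero terms only at the five
    possible values of \<open>j\<close>.\<close>
  also have "\<dots> = (\<Sum>j\<le>n. monom (int (A j)) (n - j))"
    by (rule sum.reindex_bij_witness[of _ "\<lambda>i. n - i" "\<lambda>i. n - i"]) auto
  also have "\<dots> = (\<Sum>j\<in>?J. monom (int (A j)) (n - j))"
    by (rule sum.mono_neutral_right) (use n_bounds A_eq_0 in auto)
  also have "\<dots> = monom (int (A 0)) n + monom (int (A 1)) (n - 1) + monom (int (A 2)) (n - 2)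
      + monom (int (A (q + 1))) (n - (q + 1)) + 1"
    using q_gt2 n_bounds A_n by (simp add: one_pCons monom_0)
  finally show ?thesis
    unfolding A_values Q_def by (simp add: n_eq)
qed

section \<open>The designs\<close>

text \<open>The blocks of the inversive plane: since \<open>q + 1\<close> exceeds 2, these zero sets
  are the plane sections through three points of the quadric.\<close>

definition "circles = {z. \<exists>x\<in>code. x \<noteq> (\<lambda>_. 0) \<and> z = zset x \<and> card z = q + 1}"

lemma circles_props: "z \<in> circles \<Longrightarrow> z \<subseteq> {..<n} \<and> card z = q + 1"
  using zset_subset by (auto simp: circles_def)

text \<open>The words vanishing on \<open>T\<close> number \<open>q\<^sup>2 > 1\<close>, so one of
  them is nonzero; all such words have the same zero set.\<close>

lemma circle_through:
  assumes "T \<subseteq> {..<n}" "card T = 3"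
  obtains x where "x \<in> code" "x \<noteq> (\<lambda>_. 0)" "T \<subseteq> zset x" "zset x \<in> circles"
    "{z \<in> circles. T \<subseteq> z} = {zset x}"
proof -
  have "card {x \<in> code. T \<subseteq> zset x} = q\<^sup>2"
    using card_vanishing[of T] assms by simp
  then have "\<not> {x \<in> code. T \<subseteq> zset x} \<subseteq> {\<lambda>_. 0}"
    using card_mono[of "{\<lambda>_. 0}" "{x \<in> code. T \<subseteq> zset x}"] q_powers by auto
  then obtain x where x: "x \<in> code" "x \<noteq> (\<lambda>_. 0)" "T \<subseteq> zset x" by blast
  have "card (zset x) = q + 1"
    by (rule card_zset_secant[OF x(1,2)]) (metis assms(2) card_mono finite_zset x(3))
  then have c: "zset x \<in> circles" using x by (auto simp: circles_def)
  have "{z \<in> circles. T \<subseteq> z} = {zset x}"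
    using zset_unique[OF x(1,2) _ _ x(3) _ assms(2)] c x(3) by (auto simp: circles_def)
  then show ?thesis using that x c by blast
qed

lemma card_circles_through: "T \<subseteq> {..<n} \<Longrightarrow> card T = 3 \<Longrightarrow> card {z \<in> circles. T \<subseteq> z} = 1"
  using circle_through by (metis card_1_singleton_iff One_nat_def)

lemma blocks_code: "blocks n code (q\<^sup>2 - q) = (\<lambda>z. {..<n} - z) ` circles"
proof -
  have "hweight n x = q\<^sup>2 - q \<longleftrightarrow> x \<noteq> (\<lambda>_. 0) \<and> card (zset x) = q + 1" if x: "x \<in> code" for x
  proof -
    have "n - card (zset x) = q\<^sup>2 - q \<longleftrightarrow> card (zset x) = q + 1"
      using card_zset_le[of x] q_powers by (auto simp: n_eq)
    moreover have "card (zset x) = q + 1 \<Longrightarrow> x \<noteq> (\<lambda>_. 0)"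
      using zset_eq_full_iff[OF x] n_bounds by auto
    ultimately show ?thesis by (auto simp: hweight_eq)
  qed
  then show ?thesis by (auto simp: blocks_def circles_def supp_eq image_iff)
qed

text \<open>A minimum weight support contains \<open>T\<close> exactly when the complementary circle
  avoids \<open>T\<close>, so blocks avoiding three points of the inversive plane are
  counted.\<close>

lemma design_code: "is_design 3 (q\<^sup>2 + 1) (q\<^sup>2 - q) ((q\<^sup>2 - q - 1) * (q - 2)) (blocks n code (q\<^sup>2 - q))"
  unfolding is_design_def n_eq[symmetric]
proof (intro conjI ballI allI impI)
  fix b assume "b \<in> blocks n code (q\<^sup>2 - q)"
  then obtain z where z: "z \<in> circles" "b = {..<n} - z" by (auto simp: blocks_code)
  then show "b \<subseteq> {..<n}" "card b = q\<^sup>2 - q"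
    using circles_props[OF z(1)] by (auto simp: card_Diff_subset finite_subset n_eq)
next
  fix T assume T: "T \<subseteq> {..<n} \<and> card T = 3"
  have "{b \<in> blocks n code (q\<^sup>2 - q). T \<subseteq> b} = (\<lambda>z. {..<n} - z) ` {z \<in> circles. z \<inter> T = {}}"
    using T by (auto simp: blocks_code)
  moreover have "inj_on (\<lambda>z. {..<n} - z) {z \<in> circles. z \<inter> T = {}}"
    by (rule inj_onI) (use circles_props in blast)
  moreover have "card {z \<in> circles. z \<inter> T = {}} = (q\<^sup>2 - q - 1) * (q - 2)"
    by (rule inversive_plane_blocks_avoiding[where Y = "{..<n}"])
      (use T n_eq q_gt2 circles_props card_circles_through in auto)
  ultimately show "card {b \<in> blocks n code (q\<^sup>2 - q). T \<subseteq> b} = (q\<^sup>2 - q - 1) * (q - 2)"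
    by (simp add: card_image)
qed

lemma min_dist_code: "min_dist n code = q\<^sup>2 - q"
  unfolding min_dist_def
proof (rule Min_eqI)
  fix w assume "w \<in> hweight n ` (code - {\<lambda>_. 0})"
  then obtain x where x: "x \<in> code" "x \<noteq> (\<lambda>_. 0)" "w = n - card (zset x)"
    by (auto simp: hweight_eq)
  then have "card (zset x) \<le> q + 1"
    using card_zset_cases[OF x(1)] zset_eq_full_iff[OF x(1)] q_gt2 by auto
  then show "q\<^sup>2 - q \<le> w" using x(3) by (simp add: n_eq)
next
  have "{0, 1, 2} \<subseteq> {..<n}" using n_bounds by auto
  then obtain x where x: "x \<in> code" "x \<noteq> (\<lambda>_. 0)" "zset x \<in> circles"
    using circle_through[where T = "{0, 1, 2}"] by auto
  then have "card (zset x) = q + 1" using circles_props by blast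
  moreover have "n - (q + 1) = q\<^sup>2 - q" by (simp add: n_eq)
  ultimately have "hweight n x = q\<^sup>2 - q" by (simp only: hweight_eq)
  then show "q\<^sup>2 - q \<in> hweight n ` (code - {\<lambda>_. 0})" using x by force
qed simp

end

section \<open>The dual code\<close>

context ovoid
begin

abbreviation "dual \<equiv> dual_code K n code"

lemma hweight_eq_card_supp: "hweight n d = card (supp n d)"
  by (simp add: hweight_def supp_def)

lemma supp_subset: "supp n d \<subseteq> {..<n}"
  by (auto simp: supp_def)

lemma finite_supp: "finite (supp n d)"
  by (simp add: supp_def)

text \<open>If \<open>x\<close> vanishes on the support of \<open>d\<close> except possibly at
  \<open>i\<close>, orthogonality reduces to one term.\<close>

lemma dual_sum:
  assumes "d \<in> dual" "x \<in> code" "supp n d \<subseteq> insert i (zset x)" "i < n"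
  shows "x i * d i = 0"
proof -
  have "(\<Sum>j<n. x j * d j) = (\<Sum>j\<in>{i}. x j * d j)"
    by (rule sum.mono_neutral_right) (use assms(3,4) in \<open>auto simp: supp_def zset_def\<close>)
  then show ?thesis using assms(1,2) by (simp add: dual_code_def)
qed

text \<open>On a support of at most three points, \<open>card_vanishing\<close> provides a codeword
  that vanishes everywhere except at one chosen point \<open>i\<close>; \<open>dual_sum\<close> then
  contradicts \<open>d i \<noteq> 0\<close>.\<close>

lemma dual_weight_ge_4:
  assumes d: "d \<in> dual" "d \<noteq> (\<lambda>_. 0)"
  shows "4 \<le> hweight n d"
proof (rule ccontr)
  assume "\<not> 4 \<le> hweight n d"
  then have S: "card (supp n d) \<le> 3" by (simp add: hweight_eq_card_supp)
  obtain i where i: "d i \<noteq> 0" using d(2) by blast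
  then have "i < n" using d(1) by (auto simp: dual_code_def vecs_def not_less[symmetric])
  then have iS: "i \<in> supp n d" using i by (simp add: supp_def)
  let ?S = "supp n d" and ?T = "supp n d - {i}"
  have cT: "card ?S = Suc (card ?T)"
    by (rule card.remove[OF finite_supp iS])
  have "{x \<in> code. ?T \<subseteq> zset x} \<noteq> {x \<in> code. ?S \<subseteq> zset x}"
  proof
    assume "{x \<in> code. ?T \<subseteq> zset x} = {x \<in> code. ?S \<subseteq> zset x}"
    moreover have "?T \<subseteq> {..<n}" "card ?T \<le> 3" using supp_subset cT S by auto
    ultimately have "q ^ (8 - 2 * card ?T) = q ^ (8 - 2 * card ?S)"
      using card_vanishing[OF supp_subset S] card_vanishing[of ?T] by simp
    then have "8 - 2 * card ?T = 8 - 2 * card ?S"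
      using q_gt2 by (simp add: power_inject_exp)
    then show False using cT S by linarith
  qed
  then obtain x where x: "x \<in> code" "?T \<subseteq> zset x" "\<not> ?S \<subseteq> zset x" by blast
  then have "x i \<noteq> 0" using \<open>i < n\<close> by (auto simp: zset_def)
  moreover have "x i * d i = 0"
    using dual_sum[OF d(1) x(1) _ \<open>i < n\<close>] x(2) by blast
  ultimately show False using i by simp
qed

text \<open>The relation among four points of a circle is a dual word supported inside
  \<open>X\<close>. The minimum weight 4 forces all its coefficients to be nonzero.\<close>

lemma circle_word_supp:
  assumes X: "card X = 4" "X \<subseteq> z" "z \<in> circles"
  obtains d where "d \<in> dual" "supp n d = X"
proof -
  obtain x where x: "x \<in> code" "x \<noteq> (\<lambda>_. 0)" "z = zset x" using X(3) by (auto simp: circles_def)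
  obtain i Y where iY: "X = insert i Y" "i \<notin> Y" "card Y = 3"
    using X(1) card_Suc_eq[of X 3] by auto
  then obtain i1 i2 i3 where Y: "Y = {i1, i2, i3}" and ne: "i1 \<noteq> i2" "i1 \<noteq> i3" "i2 \<noteq> i3"
    by (auto simp: card_3_iff)
  have ni: "i \<noteq> i1" "i \<noteq> i2" "i \<noteq> i3" using iY Y by auto
  have sub: "{i, i1, i2, i3} \<subseteq> zset x" using X(2) x(3) iY Y by simp
  have finX: "finite X" using iY Y by simp
  have Xn: "X \<subseteq> {..<n}" using X(2) x(3) zset_subset by blast
  from zset_dependent[OF x(1,2) sub ne]
  obtain x1 x2 x3 where xs: "x1 \<in> K" "x2 \<in> K" "x3 \<in> K"
    and dep: "\<And>y. y \<in> code \<Longrightarrow> y i = x1 * y i1 + x2 * y i2 + x3 * y i3" by blast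
  define d where "d = (\<lambda>_. 0)(i := - 1, i1 := x1, i2 := x2, i3 := x3)"
  have vals: "d i = - 1" "d i1 = x1" "d i2 = x2" "d i3 = x3"
    using ni ne by (simp_all add: d_def)
  have d0: "d j = 0" if "j \<notin> X" for j using that by (auto simp: d_def iY Y)
  have "d j \<in> K" for j using xs by (simp add: d_def K_closed)
  moreover have "d j = 0" if "n \<le> j" for j using d0 that Xn by fastforce
  ultimately have "d \<in> vecs K n" by (simp add: vecs_def)
  moreover have "(\<Sum>j<n. y j * d j) = 0" if y: "y \<in> code" for y
  proof -
    have "(\<Sum>j<n. y j * d j) = (\<Sum>j\<in>X. y j * d j)"
      by (rule sum.mono_neutral_right) (use Xn d0 in auto)
    also have "\<dots> = y i * d i + (y i1 * d i1 + (y i2 * d i2 + y i3 * d i3))"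
      using ni ne by (simp add: iY Y)
    also have "\<dots> = 0" unfolding vals dep[OF y] by (simp add: algebra_simps)
    finally show ?thesis .
  qed
  ultimately have D: "d \<in> dual" by (simp add: dual_code_def)
  have "d \<noteq> (\<lambda>_. 0)" using vals(1) by auto
  then have "4 \<le> card (supp n d)" using dual_weight_ge_4[OF D] by (simp add: hweight_eq_card_supp)
  moreover have "supp n d \<subseteq> X" using d0 by (auto simp: supp_def)
  ultimately have "supp n d = X" using card_seteq[OF finX] X(1) by simp
  then show ?thesis using that D by blast
qed

text \<open>For the forward inclusion, a nonzero codeword vanishing on three points of the support
  must by orthogonality vanish at the fourth, so all four lie on one circle.\<close>

lemma blocks_dual: "blocks n dual 4 = {X. card X = 4 \<and> (\<exists>z\<in>circles. X \<subseteq> z)}"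
proof (intro equalityI subsetI)
  fix X assume "X \<in> blocks n dual 4"
  then obtain d where d: "d \<in> dual" "X = supp n d" "card X = 4"
    by (auto simp: blocks_def hweight_eq_card_supp)
  obtain i T where iT: "X = insert i T" "i \<notin> T" "card T = 3"
    using d(3) card_Suc_eq[of X 3] by auto
  have Xn: "X \<subseteq> {..<n}" using d(2) supp_subset by simp
  then have Tn: "T \<subseteq> {..<n}" and "i < n" using iT by auto
  obtain x where x: "x \<in> code" "x \<noteq> (\<lambda>_. 0)" "T \<subseteq> zset x" "zset x \<in> circles" "{z \<in> circles. T \<subseteq> z} = {zset x}"
    by (rule circle_through[OF Tn iT(3)])
  have "x i * d i = 0"
    by (rule dual_sum[OF d(1) x(1) _ \<open>i < n\<close>]) (use d(2) iT x(3) in auto)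
  moreover have "d i \<noteq> 0" using d(2) iT by (auto simp: supp_def)
  ultimately have "i \<in> zset x" using \<open>i < n\<close> by (simp add: zset_def)
  then show "X \<in> {X. card X = 4 \<and> (\<exists>z\<in>circles. X \<subseteq> z)}"
    using iT(1) d(3) x by auto
next
  fix X assume "X \<in> {X. card X = 4 \<and> (\<exists>z\<in>circles. X \<subseteq> z)}"
  then obtain z where "card X = 4" "X \<subseteq> z" "z \<in> circles" by blast
  then obtain d where "d \<in> dual" "supp n d = X" using circle_word_supp by blast
  then show "X \<in> blocks n dual 4"
    using \<open>card X = 4\<close> by (auto simp: blocks_def hweight_eq_card_supp)
qed

text \<open>The three points determine their circle, and a block through them adds one of its
  \<open>q + 1 - 3\<close> other points.\<close>

lemma design_dual: "is_design 3 (q\<^sup>2 + 1) 4 (q - 2) (blocks n dual 4)"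
  unfolding is_design_def n_eq[symmetric] blocks_dual
proof (intro conjI ballI allI impI)
  fix b assume "b \<in> {X. card X = 4 \<and> (\<exists>z\<in>circles. X \<subseteq> z)}"
  then show "b \<subseteq> {..<n}" "card b = 4" using circles_props by blast+
next
  fix T assume T: "T \<subseteq> {..<n} \<and> card T = 3"
  then have finT: "finite T" using finite_subset by blast
  obtain x where x0: "x \<in> code" "x \<noteq> (\<lambda>_. 0)"
    and x: "T \<subseteq> zset x" "zset x \<in> circles" "{z \<in> circles. T \<subseteq> z} = {zset x}"
    by (rule circle_through[OF conjunct1[OF T] conjunct2[OF T]])
  have "{b \<in> {X. card X = 4 \<and> (\<exists>z\<in>circles. X \<subseteq> z)}. T \<subseteq> b} = (\<lambda>i. insert i T) ` (zset x - T)" (is "?L = ?R")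
  proof (intro equalityI subsetI)
    fix b assume "b \<in> ?L"
    then obtain z where b: "card b = 4" "T \<subseteq> b" "b \<subseteq> z" "z \<in> circles" by blast
    then have "z = zset x" using x(3) by blast
    have "card (b - T) = 1" using b T finT by (simp add: card_Diff_subset)
    then obtain i where "b - T = {i}" by (auto simp: card_1_singleton_iff)
    then have "b = insert i T" "i \<in> zset x - T" using b \<open>z = zset x\<close> by auto
    then show "b \<in> ?R" by blast
  next
    fix b assume "b \<in> ?R"
    then obtain i where "b = insert i T" "i \<in> zset x" "i \<notin> T" by blast
    then show "b \<in> ?L" using x T finT by auto
  qed
  moreover have "inj_on (\<lambda>i. insert i T) (zset x - T)" by (auto simp: inj_on_def)
  moreover have "card (zset x - T) = q - 2"
    using circles_props[OF x(2)] T finT x(1) by (simp add: card_Diff_subset)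
  ultimately show "card {b \<in> {X. card X = 4 \<and> (\<exists>z\<in>circles. X \<subseteq> z)}. T \<subseteq> b} = q - 2"
    by (simp only: card_image)
qed

lemma min_dist_dual: "min_dist n dual = 4"
  unfolding min_dist_def
proof (rule Min_eqI)
  \<comment> \<open>\<open>Min\<close> needs a finite set; the vectors are functions on all
    naturals, so finiteness comes from the finitely many restrictions to
    \<open>{..<n}\<close>.\<close>
  have "vecs K n \<subseteq> (\<lambda>f i. if i < n then f i else 0) ` ({..<n} \<rightarrow>\<^sub>E K)"
  proof
    fix d assume "d \<in> vecs K n"
    then have "d = (\<lambda>i. if i < n then restrict d {..<n} i else 0)" "restrict d {..<n} \<in> {..<n} \<rightarrow>\<^sub>E K"
      by (auto simp: vecs_def fun_eq_iff)
    then show "d \<in> (\<lambda>f i. if i < n then f i else 0) ` ({..<n} \<rightarrow>\<^sub>E K)" by blast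
  qed
  then have "finite (vecs K n)"
    by (rule finite_subset) (intro finite_imageI finite_PiE, auto)
  moreover have "dual \<subseteq> vecs K n" by (auto simp: dual_code_def)
  ultimately show "finite (hweight n ` (dual - {\<lambda>_. 0}))"
    by (meson finite_Diff finite_imageI finite_subset)
  fix w assume "w \<in> hweight n ` (dual - {\<lambda>_. 0})"
  then show "4 \<le> w" using dual_weight_ge_4 by auto
next
  have "{0, 1, 2} \<subseteq> {..<n}" using n_bounds by auto
  then obtain x where x: "zset x \<in> circles"
    using circle_through[where T = "{0, 1, 2}"] by auto
  then have "4 \<le> card (zset x)" using circles_props q_gt2 by fastforce
  then obtain X where X: "X \<subseteq> zset x" "card X = 4"
    using obtain_subset_with_card_n by metis
  then obtain d where d: "d \<in> dual" "supp n d = X" using circle_word_supp x by blast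
  then have "d \<noteq> (\<lambda>_. 0)" "hweight n d = 4"
    using X(2) by (auto simp: hweight_eq_card_supp) (auto simp: supp_def)
  then show "4 \<in> hweight n ` (dual - {\<lambda>_. 0})" using d(1) by force
qed

section \<open>Dimension of the dual code\<close>

lemma code_sum:
  assumes "finite I" "\<And>j. j \<in> I \<Longrightarrow> f j \<in> code"
  shows "(\<lambda>i. \<Sum>j\<in>I. f j i) \<in> code"
  using assms
proof (induction I)
  case empty
  then show ?case using code_zero by simp
next
  case (insert j I)
  then have "(\<lambda>i. f j i + (\<Sum>j\<in>I. f j i)) \<in> code" by (intro code_add) auto
  then show ?case using insert by simp
qed

text \<open>Three points and a fourth one off their circle form an information set.\<close>

lemma information_set:
  "\<exists>I\<subseteq>{..<n}. card I = 4 \<and> (\<forall>x\<in>code. I \<subseteq> zset x \<longrightarrow> x = (\<lambda>_. 0))"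
proof -
  let ?T = "{0, 1, 2 :: nat}"
  have T: "?T \<subseteq> {..<n}" "card ?T = 3" using n_bounds by auto
  obtain x where x: "x \<in> code" "x \<noteq> (\<lambda>_. 0)" "?T \<subseteq> zset x" "zset x \<in> circles" "{z \<in> circles. ?T \<subseteq> z} = {zset x}"
    by (rule circle_through[OF T])
  have "zset x \<noteq> {..<n}" using circles_props[OF x(4)] n_bounds by auto
  then obtain i where i: "i < n" "i \<notin> zset x" using zset_subset by blast
  show ?thesis
  proof (intro exI[of _ "insert i ?T"] conjI ballI impI)
    show "insert i ?T \<subseteq> {..<n}" using T i by simp
    have "i \<notin> ?T" using i(2) x(3) by blast
    then show "card (insert i ?T) = 4" by simp
    fix y assume y: "y \<in> code" "insert i ?T \<subseteq> zset y"
    show "y = (\<lambda>_. 0)"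
    proof (rule ccontr)
      assume "y \<noteq> (\<lambda>_. 0)"
      then have "zset y = zset x"
        using zset_unique[OF y(1) _ x(1,2) _ x(3) T(2)] y(2) by blast
      then show False using i(2) y(2) by blast
    qed
  qed
qed

text \<open>Systematic form: a basis of the code that is the identity on an information set
  \<open>I\<close> turns duality into four check equations, which express the coordinates in
  \<open>I\<close> through the free ones outside.\<close>

lemma card_dual: "card dual = (q\<^sup>2) ^ (q\<^sup>2 - 3)"
proof -
  obtain I where I: "I \<subseteq> {..<n}" "card I = 4" and triv: "\<And>x. x \<in> code \<Longrightarrow> I \<subseteq> zset x \<Longrightarrow> x = (\<lambda>_. 0)"
    using information_set by blast
  have finI: "finite I" using I(1) finite_subset by blast
  \<comment> \<open>A nonzero word vanishing on the other three points of \<open>I\<close> cannot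
    vanish at \<open>j\<close>, so it can be normalised there.\<close>
  have "\<exists>e. e \<in> code \<and> (\<forall>i\<in>I. e i = (if i = j then 1 else 0))" if j: "j \<in> I" for j
  proof -
    have Ij: "I - {j} \<subseteq> {..<n}" "card (I - {j}) = 3" using I j by auto
    obtain x where x: "x \<in> code" "x \<noteq> (\<lambda>_. 0)" "I - {j} \<subseteq> zset x" "zset x \<in> circles" "{z \<in> circles. I - {j} \<subseteq> z} = {zset x}"
      by (rule circle_through[OF Ij])
    have xj: "x j \<noteq> 0"
    proof
      assume "x j = 0"
      then have "I \<subseteq> zset x" using x(3) I j by (auto simp: zset_def)
      then show False using triv x by blast
    qed
    have "x j \<in> K" using x(1) code_vecs j I(1) by (auto simp: vecs_def)
    then have "(\<lambda>i. 1 / x j * x i) \<in> code" by (intro code_scale x(1) K_closed)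
    moreover have "\<forall>i\<in>I. 1 / x j * x i = (if i = j then 1 else 0)"
      using xj x(3) by (auto simp: zset_def)
    ultimately show ?thesis by blast
  qed
  then obtain e where e: "\<And>j. j \<in> I \<Longrightarrow> e j \<in> code"
    and eI: "\<And>j i. j \<in> I \<Longrightarrow> i \<in> I \<Longrightarrow> e j i = (if i = j then 1 else 0)"
    by metis
  \<comment> \<open>The word minus its expansion vanishes on the information set, hence
    everywhere.\<close>
  have expand: "x i = (\<Sum>j\<in>I. x j * e j i)" if x: "x \<in> code" for x i
  proof -
    have xK: "x j \<in> K" if "j \<in> I" for j using x code_vecs that I(1) by (auto simp: vecs_def)
    have "(\<lambda>i. \<Sum>j\<in>I. - x j * e j i) \<in> code"
      by (rule code_sum[OF finI]) (intro code_scale e K_closed xK)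
    then have "(\<lambda>i. x i + (\<Sum>j\<in>I. - x j * e j i)) \<in> code" by (rule code_add[OF x])
    moreover have "x i + (\<Sum>j\<in>I. - x j * e j i) = 0" if "i \<in> I" for i
    proof -
      have "(\<Sum>j\<in>I. - x j * e j i) = (\<Sum>j\<in>I. if i = j then - x j else 0)"
        by (rule sum.cong) (use eI that in auto)
      then show ?thesis using finI that by simp
    qed
    then have "I \<subseteq> zset (\<lambda>i. x i + (\<Sum>j\<in>I. - x j * e j i))"
      using I(1) by (auto simp: zset_def)
    ultimately have "(\<lambda>i. x i + (\<Sum>j\<in>I. - x j * e j i)) = (\<lambda>_. 0)" by (rule triv)
    then have "x i + (\<Sum>j\<in>I. - x j * e j i) = 0" by (rule fun_cong)
    then show ?thesis by (simp add: sum_negf)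
  qed
  define J where "J = {..<n} - I"
  have finJ: "finite J" by (simp add: J_def)
  have IJ: "I \<inter> J = {}" "{..<n} = I \<union> J" using I(1) by (auto simp: J_def)
  have split: "(\<Sum>i<n. e j i * d i) = d j + (\<Sum>i\<in>J. e j i * d i)" if j: "j \<in> I" for d j
  proof -
    have "(\<Sum>i\<in>I. e j i * d i) = (\<Sum>i\<in>I. if i = j then d i else 0)"
      by (rule sum.cong) (use eI j in auto)
    also have "\<dots> = d j" using finI j by simp
    finally show ?thesis unfolding IJ(2) by (subst sum.union_disjoint[OF finI finJ IJ(1)]) simp
  qed
  have dual_iff: "d \<in> dual \<longleftrightarrow> d \<in> vecs K n \<and> (\<forall>j\<in>I. d j = - (\<Sum>i\<in>J. e j i * d i))" for d
  proof
    assume d: "d \<in> dual"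
    have "d j = - (\<Sum>i\<in>J. e j i * d i)" if "j \<in> I" for j
    proof -
      have "(\<Sum>i<n. e j i * d i) = 0" using d e[OF that] by (simp add: dual_code_def)
      then show ?thesis unfolding split[OF that] by (simp add: eq_neg_iff_add_eq_0)
    qed
    then show "d \<in> vecs K n \<and> (\<forall>j\<in>I. d j = - (\<Sum>i\<in>J. e j i * d i))"
      using d by (simp add: dual_code_def)
  next
    assume d: "d \<in> vecs K n \<and> (\<forall>j\<in>I. d j = - (\<Sum>i\<in>J. e j i * d i))"
    have "(\<Sum>i<n. x i * d i) = 0" if x: "x \<in> code" for x
    proof -
      have "(\<Sum>i<n. x i * d i) = (\<Sum>i<n. \<Sum>j\<in>I. x j * (e j i * d i))"
        by (rule sum.cong[OF refl], subst expand[OF x]) (simp add: sum_distrib_right mult.assoc)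
      also have "\<dots> = (\<Sum>j\<in>I. \<Sum>i<n. x j * (e j i * d i))"
        by (rule sum.swap)
      also have "\<dots> = (\<Sum>j\<in>I. x j * (\<Sum>i<n. e j i * d i))"
        by (simp add: sum_distrib_left)
      also have "\<dots> = 0"
        by (rule sum.neutral) (use d split in \<open>simp add: eq_neg_iff_add_eq_0\<close>)
      finally show ?thesis .
    qed
    then show "d \<in> dual" using d by (simp add: dual_code_def)
  qed
  have eK: "e j i \<in> K" if "j \<in> I" "i \<in> J" for i j
    using e[OF that(1)] code_vecs that(2) by (auto simp: vecs_def J_def)
  \<comment> \<open>Inverse of restriction to \<open>J\<close>: the check equations fill in
    \<open>I\<close>, and positions from \<open>n\<close> on get 0 as \<open>vecs\<close>
    demands.\<close>
  let ?g = "\<lambda>f i. if i \<in> J then f i else if i \<in> I then - (\<Sum>i'\<in>J. e i i' * f i') else 0"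
  have "bij_betw (\<lambda>d. restrict d J) dual (J \<rightarrow>\<^sub>E K)"
  proof (rule bij_betw_byWitness[where f' = ?g])
    show "\<forall>d\<in>dual. ?g (restrict d J) = d"
    proof
      fix d assume d: "d \<in> dual"
      have "?g (restrict d J) i = d i" for i
      proof -
        consider "i \<in> J" | "i \<in> I" "i \<notin> J" | "\<not> i < n" using IJ(2) by auto
        then show ?thesis
        proof cases
          case 2
          then show ?thesis using d dual_iff by auto
        next
          case 3
          then have "i \<notin> I" "i \<notin> J" using IJ(2) by auto
          then show ?thesis using 3 d by (simp add: dual_iff vecs_def)
        qed simp
      qed
      then show "?g (restrict d J) = d" by (rule ext)
    qed
    show "\<forall>f\<in>J \<rightarrow>\<^sub>E K. restrict (?g f) J = f"
      by (auto simp: fun_eq_iff PiE_def extensional_def restrict_def)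
    show "(\<lambda>d. restrict d J) ` dual \<subseteq> J \<rightarrow>\<^sub>E K"
      by (rule image_subsetI) (simp add: restrict_PiE_iff dual_iff vecs_def J_def)
    show "?g ` (J \<rightarrow>\<^sub>E K) \<subseteq> dual"
    proof (rule image_subsetI)
      fix f assume f: "f \<in> J \<rightarrow>\<^sub>E K"
      have fK: "f i \<in> K" if "i \<in> J" for i using f that by auto
      have "?g f i \<in> K" for i
        using fK eK by (auto intro!: K_closed K_sum)
      moreover have "?g f i = 0" if "i \<ge> n" for i
        using that I(1) by (auto simp: J_def)
      ultimately have "?g f \<in> vecs K n" unfolding vecs_def mem_Collect_eq by blast
      moreover have "?g f j = - (\<Sum>i\<in>J. e j i * ?g f i)" if "j \<in> I" for j
      proof -
        have "j \<notin> J" using that IJ(1) by blast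
        then show ?thesis using that by simp
      qed
      ultimately show "?g f \<in> dual" unfolding dual_iff by blast
    qed
  qed
  then have "card dual = card (J \<rightarrow>\<^sub>E K)" by (rule bij_betw_same_card)
  also have "\<dots> = (q\<^sup>2) ^ card J" using finJ by (simp add: card_PiE card_K)
  also have "card J = q\<^sup>2 - 3" using I finI by (simp add: J_def card_Diff_subset n_eq)
  finally show ?thesis .
qed

end

section \<open>Constacyclic codes\<close>

lemma prod_linear_dvd:
  fixes p :: "'a::field poly"
  assumes "finite A" "\<And>a. a \<in> A \<Longrightarrow> poly p a = 0"
  shows "(\<Prod>a\<in>A. [:- a, 1:]) dvd p"
  using assms
proof (induction A)
  case (insert a A)
  then obtain s where s: "p = (\<Prod>a\<in>A. [:- a, 1:]) * s" by (auto elim: dvdE)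
  have "poly (\<Prod>a\<in>A. [:- a, 1:]) a \<noteq> 0"
    using insert.hyps by (auto simp: poly_prod)
  then have "poly s a = 0" using insert.prems[of a] by (simp add: s)
  then obtain t where "s = [:- a, 1:] * t" by (auto simp: poly_eq_0_iff_dvd elim: dvdE)
  then have "p = [:- a, 1:] * (\<Prod>a\<in>A. [:- a, 1:]) * t"
    by (simp only: s mult.assoc mult.left_commute)
  then show ?case unfolding prod.insert[OF insert.hyps] by (rule dvdI)
qed simp

text \<open>The product telescopes: up to a scalar, the geometric polynomial in the inverse of
  \<theta> is the cofactor of \<open>x - \<theta>\<close> in
  \<open>x ^ m - \<theta> ^ m\<close>.\<close>

lemma linear_times_geometric:
  fixes \<theta> :: "'a::field"
  assumes "\<theta> * \<eta> = 1"
  shows "[:- \<theta>, 1:] * (\<Sum>i<m. monom (\<eta> ^ i) i) = smult (\<theta> * \<eta> ^ m) (monom 1 m - [:\<theta> ^ m:])"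
proof -
  have pw: "\<eta> ^ m * \<theta> ^ m = 1" for m
    using assms by (simp add: power_mult_distrib[symmetric] mult.commute)
  have "[:- \<theta>, 1:] * (\<Sum>i<m. monom (\<eta> ^ i) i) = smult \<theta> (monom (\<eta> ^ m) m) - [:\<theta>:]"
  proof (induction m)
    case (Suc m)
    have "[:- \<theta>, 1:] * monom (\<eta> ^ m) m = monom (\<eta> ^ m) (Suc m) - smult \<theta> (monom (\<eta> ^ m) m)"
      by (simp add: monom_Suc)
    moreover have "monom (\<eta> ^ m) (Suc m) = smult \<theta> (monom (\<eta> ^ Suc m) (Suc m))"
      using assms by (simp add: smult_monom mult.assoc[symmetric])
    ultimately show ?case using Suc by (simp add: distrib_left)
  qed (simp add: monom_0)
  also have "\<dots> = smult (\<theta> * \<eta> ^ m) (monom 1 m - [:\<theta> ^ m:])"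
    using pw[of m] by (simp add: smult_diff_right smult_monom mult.assoc)
  finally show ?thesis .
qed

lemma coeff_poly_of_vec: "coeff (poly_of_vec n c) i = (if i < n then c i else 0)"
  by (simp add: poly_of_vec_def coeff_sum)

lemma degree_poly_of_vec: "0 < n \<Longrightarrow> degree (poly_of_vec n c) < n"
  by (intro degree_lessI) (auto simp: coeff_poly_of_vec)

text \<open>\<open>delta_ord\<close> combines the order of \<open>delta\<close> with the 2-adic
  condition: the powers of \<open>delta\<close> with exponents below \<open>n\<close> are pairwise
  nonproportional over \<open>k\<close>.\<close>

locale constacyclic = quartic_field q phi
  for q :: nat and phi :: "'b::{field,finite} \<Rightarrow> 'b" ("\<phi>") +
  fixes n :: nat and lam delta :: 'b
  assumes n_eq: "n = q\<^sup>2 + 1"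
    and lam_k: "lam \<in> k" and lam_nonzero: "lam \<noteq> 0"
    and delta_n: "delta ^ n = lam"
    and delta_ord: "delta ^ (d * (q - 1)) = 1 \<Longrightarrow> n dvd d"
begin

lemma delta_nonzero: "delta \<noteq> 0"
  using delta_n lam_nonzero n_eq by auto

text \<open>Inverse powers, because the cofactor of \<open>x - delta\<close> in
  \<open>x ^ n - lam\<close> has coefficients proportional to them.\<close>

definition "u i = (1 / delta) ^ i"

lemma power_in_k:
  assumes "s \<in> k" "s \<noteq> 0"
  shows "s ^ (q - 1) = 1"
proof -
  have "s * s ^ (q - 1) = s ^ q" using q_gt2 by (cases q) simp_all
  also have "\<dots> = s" using assms(1) phi_eq by (simp add: k_def)
  finally show ?thesis using assms(2) by simp
qed

lemma delta_diff:
  assumes "delta ^ (i * (q - 1)) = delta ^ (j * (q - 1))" "j \<le> i"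
  shows "n dvd i - j"
proof (rule delta_ord)
  have "i * (q - 1) = (i - j) * (q - 1) + j * (q - 1)"
    using assms(2) by (simp flip: add_mult_distrib)
  then have "delta ^ ((i - j) * (q - 1)) * delta ^ (j * (q - 1)) = delta ^ (j * (q - 1))"
    using assms(1) by (simp only: power_add)
  then show "delta ^ ((i - j) * (q - 1)) = 1" using delta_nonzero by simp
qed

text \<open>The norm of \<open>u i\<close> is \<open>(1 / lam) ^ i\<close>, an element of
  \<open>k\<close>. Proportional \<open>u i\<close> and \<open>u j\<close> would have equal
  \<open>(q - 1)\<close>-th powers, so \<open>n\<close> would divide the difference of the
  indices.\<close>

sublocale ovoid q phi n u
proof
  show "n = q\<^sup>2 + 1" by (rule n_eq)
next
  fix i
  have "u i * \<phi> (\<phi> (u i)) = u i ^ n" by (simp only: phi2 n_eq power_add power_one_right mult.commute)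
  also have "\<dots> = (1 / lam) ^ i"
    by (simp add: u_def power_mult[symmetric] power_one_over delta_n[symmetric] mult.commute)
  also have "\<dots> \<in> k" using lam_k by (intro k_closed)
  finally show "u i \<in> Om" using delta_nonzero by (simp add: Om_def u_def)
next
  fix i j assume ij: "i < n" "j < n" "i \<noteq> j"
  show "u j / u i \<notin> k"
  proof
    assume "u j / u i \<in> k"
    moreover have "u j / u i = delta ^ i / delta ^ j" by (simp add: u_def power_one_over)
    ultimately have "(delta ^ i / delta ^ j) ^ (q - 1) = 1"
      using delta_nonzero by (intro power_in_k) simp_all
    then have eq: "delta ^ (i * (q - 1)) = delta ^ (j * (q - 1))"
      using delta_nonzero by (simp add: power_divide power_mult)
    show False
    proof (cases "j \<le> i")
      case True
      then show False using delta_diff[OF eq] ij by (auto dest: dvd_imp_le)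
    next
      case False
      then show False using delta_diff[OF eq[symmetric]] ij by (auto dest: dvd_imp_le)
    qed
  qed
qed

section \<open>Check polynomial, generator polynomial and descent to \<open>K\<close>\<close>

definition "M = monom 1 n - [:lam:]"
definition "roots = {delta, \<phi> delta, \<phi> (\<phi> delta), \<phi> (\<phi> (\<phi> delta))}"
lemma finite_roots: "finite roots"
  by (simp add: roots_def)

definition "h = (\<Prod>\<theta>\<in>roots. [:- \<theta>, 1:])"

text \<open>If \<phi> or its square fixed \<open>delta\<close>, then \<open>n\<close> would divide 1
  or, since \<open>q\<^sup>2 - 1 = (q + 1) * (q - 1)\<close>, the smaller number
  \<open>q + 1\<close>.\<close>

lemma conjugates_distinct: "\<phi> delta \<noteq> delta" "\<phi> (\<phi> delta) \<noteq> delta"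
proof -
  show "\<phi> delta \<noteq> delta"
  proof
    assume "\<phi> delta = delta"
    then have "delta ^ (1 * (q - 1)) = 1"
      using power_in_k[of delta] delta_nonzero by (simp add: k_def)
    then show False using delta_ord[of 1] n_bounds by simp
  qed
  show "\<phi> (\<phi> delta) \<noteq> delta"
  proof
    assume "\<phi> (\<phi> delta) = delta"
    then have "delta ^ q\<^sup>2 = delta" by (simp add: phi2)
    moreover have "q\<^sup>2 = (q + 1) * (q - 1) + 1"
      using q_gt2 by (cases q) (simp_all add: power2_eq_square)
    ultimately have "delta ^ ((q + 1) * (q - 1)) * delta = delta"
      by (simp only: power_add power_one_right)
    then have "delta ^ ((q + 1) * (q - 1)) = 1" using delta_nonzero by simp
    then have "n dvd q + 1" by (rule delta_ord)
    then show False using n_bounds by (auto dest: dvd_imp_le)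
  qed
qed

text \<open>The roots are distinct, so the product over the set has four factors. They are paired by
  the square of \<phi>, matching the two quadratic factors of the given check polynomial.\<close>

lemma h_eq: "h = [:- delta, 1:] * [:- \<phi> (\<phi> delta), 1:] * ([:- \<phi> (\<phi> (\<phi> delta)), 1:] * [:- \<phi> delta, 1:])"
proof -
  have d: "delta \<noteq> \<phi> delta" "delta \<noteq> \<phi> (\<phi> delta)" "delta \<noteq> \<phi> (\<phi> (\<phi> delta))"
    "\<phi> delta \<noteq> \<phi> (\<phi> delta)" "\<phi> delta \<noteq> \<phi> (\<phi> (\<phi> delta))" "\<phi> (\<phi> delta) \<noteq> \<phi> (\<phi> (\<phi> delta))"
  proof -
    show "delta \<noteq> \<phi> (\<phi> (\<phi> delta))"
    proof
      assume "delta = \<phi> (\<phi> (\<phi> delta))"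
      then have "\<phi> delta = \<phi> (\<phi> (\<phi> (\<phi> delta)))" by (rule arg_cong)
      then show False using conjugates_distinct by simp
    qed
  qed (use conjugates_distinct in \<open>auto dest: sym\<close>)
  have "h = [:- delta, 1:] * ([:- \<phi> delta, 1:] * ([:- \<phi> (\<phi> delta), 1:] * [:- \<phi> (\<phi> (\<phi> delta)), 1:]))"
    unfolding h_def roots_def by (simp only: prod.insert prod.empty finite.intros d insert_iff empty_iff simp_thms mult_1_right)
  then show ?thesis by (simp only: mult.assoc mult.left_commute mult.commute)
qed

lemma root_power: "\<theta> \<in> roots \<Longrightarrow> \<theta> ^ n = lam"
proof -
  have "\<phi> lam = lam" using lam_k by (simp add: k_def)
  then have "\<phi> delta ^ n = lam" "\<phi> (\<phi> delta) ^ n = lam" "\<phi> (\<phi> (\<phi> delta)) ^ n = lam"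
    unfolding phi_power[symmetric] delta_n by simp_all
  then show "\<theta> \<in> roots \<Longrightarrow> \<theta> ^ n = lam"
    unfolding roots_def using delta_n by blast
qed

definition "g = M div h"

lemma M_eq: "M = g * h"
proof -
  have "h dvd M"
    unfolding h_def by (rule prod_linear_dvd) (simp_all add: finite_roots M_def poly_monom root_power)
  then show ?thesis by (simp add: g_def)
qed

lemma degree_M: "degree M = n" and M_nonzero: "M \<noteq> 0"
proof -
  have "0 < n" using n_eq by simp
  then show d: "degree M = n"
    using degree_add_eq_left[of "- [:lam:]" "monom 1 n"] by (simp add: M_def degree_monom_eq diff_conv_add_uminus del: add_uminus_conv_diff)
  show "M \<noteq> 0" using d n_eq by auto
qed

lemma degree_h: "degree h = 4"
  unfolding h_eq by (simp add: degree_mult_eq)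

lemma degree_g: "degree g + 4 = n"
proof -
  have "g \<noteq> 0" "h \<noteq> 0" using M_nonzero M_eq by auto
  then show ?thesis using degree_M degree_h by (simp add: M_eq degree_mult_eq)
qed

text \<open>Polynomials over \<open>K\<close> are the fixed points of this ring map, so that
  membership becomes an equation in which common factors can be cancelled.\<close>

definition "cj = map_poly (\<lambda>x. \<phi> (\<phi> x))"

lemma coeff_cj: "coeff (cj p) i = \<phi> (\<phi> (coeff p i))"
  by (simp add: cj_def coeff_map_poly)

lemma cj_mult: "cj (p * r) = cj p * cj r"
  by (rule poly_eqI) (simp add: coeff_cj coeff_mult phi_sum)

lemma cj_eq_iff: "cj p = p \<longleftrightarrow> poly_over K p"
  by (auto simp: poly_over_def K_def poly_eq_iff coeff_cj)

lemma cj_linear: "cj [:- \<theta>, 1:] = [:- \<phi> (\<phi> \<theta>), 1:]"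
  by (rule poly_eqI) (simp add: coeff_cj coeff_pCons split: nat.split)

text \<open>The conjugation exchanges the factors within each pair of \<open>h\<close> and fixes
  \<open>M\<close>, hence fixes their quotient.\<close>

lemma cj_g: "cj g = g"
proof -
  have "cj h = h"
    unfolding h_eq cj_mult cj_linear phi4 by (simp only: mult.commute)
  moreover have "cj M = M"
    using lam_k k_subset_K unfolding cj_eq_iff poly_over_def M_def
    by (auto simp: coeff_pCons K_closed split: nat.split)
  ultimately have "cj g * h = g * h" using M_eq cj_mult by metis
  moreover have "h \<noteq> 0" using degree_h by auto
  ultimately show ?thesis by simp
qed

lemma quotient_over_K:
  assumes "poly_over K (g * y)"
  shows "poly_over K y"
proof -
  have "g * cj y = g * y" using assms cj_g unfolding cj_eq_iff[symmetric] cj_mult by simp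
  moreover have "g \<noteq> 0" using M_nonzero M_eq by auto
  ultimately show ?thesis by (simp add: cj_eq_iff)
qed

definition "C = constacyclic_code_check K n lam h"

lemma C_iff: "x \<in> C \<longleftrightarrow> x \<in> vecs K n \<and> (\<exists>a. poly_over K a \<and> poly_of_vec n x = (a * g) mod M)"
  by (simp add: C_def constacyclic_code_check_def Let_def g_def M_def)

lemma poly_over_of_vec: "x \<in> vecs K n \<Longrightarrow> poly_over K (poly_of_vec n x)"
  by (auto simp: poly_over_def coeff_poly_of_vec vecs_def K_closed)

text \<open>The trace form splits a word into four geometric polynomials, one for each root of the
  check polynomial.\<close>

lemma poly_of_word:
  defines "R \<equiv> \<lambda>\<theta>. \<Sum>i<n. monom ((1 / \<theta>) ^ i) i"
  shows "poly_of_vec n (word a c) = smult a (R delta) + smult c (R (\<phi> delta))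
    + smult (\<phi> (\<phi> a)) (R (\<phi> (\<phi> delta))) + smult (\<phi> (\<phi> c)) (R (\<phi> (\<phi> (\<phi> delta))))"
  by (rule poly_eqI) (simp add: R_def coeff_poly_of_vec coeff_sum word_def L_def u_def)

lemma M_dvd_geometric:
  assumes "\<theta> \<in> roots"
  shows "M dvd h * (\<Sum>i<n. monom ((1 / \<theta>) ^ i) i)"
proof -
  have "\<theta> \<noteq> 0" using assms delta_nonzero by (auto simp: roots_def)
  then have "\<theta> * (1 / \<theta>) = 1" by simp
  from linear_times_geometric[OF this, of n]
  have "[:- \<theta>, 1:] * (\<Sum>i<n. monom ((1 / \<theta>) ^ i) i) = smult (\<theta> * (1 / \<theta>) ^ n) M"
    unfolding root_power[OF assms] M_def .
  then have "M dvd [:- \<theta>, 1:] * (\<Sum>i<n. monom ((1 / \<theta>) ^ i) i)"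
    by (simp only: dvd_smult dvd_refl)
  moreover have "[:- \<theta>, 1:] dvd h"
    unfolding h_def by (rule dvd_prodI) (use assms in \<open>simp_all add: roots_def\<close>)
  ultimately show ?thesis by (meson dvd_trans mult_dvd_mono dvd_refl)
qed

text \<open>Each geometric summand times \<open>h\<close> is divisible by \<open>M = g * h\<close>;
  cancelling \<open>h\<close> exhibits the word as a multiple of \<open>g\<close> with cofactor over
  \<open>K\<close>. Its degree is below \<open>n\<close>, so reduction modulo \<open>M\<close>
  changes nothing.\<close>

lemma code_subset_C: "code \<subseteq> C"
proof
  fix x assume x: "x \<in> code"
  then obtain a c where ac: "x = word a c" by (auto simp: code_def)
  let ?P = "poly_of_vec n x"
  have "M dvd h * ?P"
    unfolding ac poly_of_word distrib_left mult_smult_right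
    by (intro dvd_add dvd_smult M_dvd_geometric) (simp_all add: roots_def)
  then obtain y where "h * ?P = M * y" by (elim dvdE)
  then have "h * ?P = h * (g * y)" by (simp only: M_eq mult.assoc mult.left_commute mult.commute)
  moreover have "h \<noteq> 0" using degree_h by auto
  ultimately have P: "?P = g * y" by simp
  have xK: "x \<in> vecs K n" using x code_vecs by blast
  then have "poly_over K y" using poly_over_of_vec quotient_over_K P by metis
  moreover have "?P = (y * g) mod M"
    using degree_poly_of_vec[of n x] degree_M n_eq P by (simp add: mod_poly_less mult.commute)
  ultimately show "x \<in> C" using xK C_iff by blast
qed

text \<open>Since \<open>g\<close> divides \<open>M\<close>, reduction keeps multiples of
  \<open>g\<close>; the cofactor has degree at most 3. This bounds the size of \<open>C\<close> by
  \<open>q ^ 8\<close>.\<close>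

lemma C_subset: "C \<subseteq> (\<lambda>(a, b, c, d) i. coeff (g * [:a, b, c, d:]) i) ` (K \<times> K \<times> K \<times> K)"
proof
  fix x assume x: "x \<in> C"
  then have xK: "x \<in> vecs K n" using C_iff by blast
  let ?P = "poly_of_vec n x"
  obtain a where "?P = (a * g) mod M" using x C_iff by blast
  moreover have "g dvd M" using M_eq by simp
  ultimately have "g dvd ?P" by (simp add: dvd_mod)
  then obtain y where y: "?P = g * y" by (elim dvdE)
  have yK: "poly_over K y" using poly_over_of_vec[OF xK] quotient_over_K y by metis
  have "degree y \<le> 3"
  proof (cases "y = 0")
    case False
    have "g \<noteq> 0" using M_nonzero M_eq by auto
    then have "degree g + degree y = degree ?P" using y False by (simp add: degree_mult_eq)
    then show ?thesis using degree_poly_of_vec[of n x] n_eq degree_g by linarith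
  qed simp
  then have y_eq: "y = [:coeff y 0, coeff y 1, coeff y 2, coeff y 3:]"
    by (intro poly_eqI)
      (auto simp: coeff_pCons numeral_2_eq_2 numeral_3_eq_3 coeff_eq_0 split: nat.split)
  have "x i = coeff ?P i" for i
    using xK by (simp add: coeff_poly_of_vec vecs_def)
  then have "x = (\<lambda>(a, b, c, d) i. coeff (g * [:a, b, c, d:]) i) (coeff y 0, coeff y 1, coeff y 2, coeff y 3)"
    unfolding case_prod_conv y_eq[symmetric] y by (rule ext)
  then show "x \<in> (\<lambda>(a, b, c, d) i. coeff (g * [:a, b, c, d:]) i) ` (K \<times> K \<times> K \<times> K)"
    using yK unfolding poly_over_def by blast
qed

text \<open>The trace words are contained in \<open>C\<close> and already number
  \<open>q ^ 8\<close>.\<close>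

lemma C_eq_code: "C = code"
proof (rule card_seteq[symmetric])
  let ?S = "(\<lambda>(a, b, c, d) i. coeff (g * [:a, b, c, d:]) i) ` (K \<times> K \<times> K \<times> K)"
  have fin: "finite ?S" by simp
  then show "finite C" using C_subset finite_subset by blast
  show "code \<subseteq> C" by (rule code_subset_C)
  have "card C \<le> card ?S" by (rule card_mono[OF fin C_subset])
  also have "\<dots> \<le> card (K \<times> K \<times> K \<times> K)" by (rule card_image_le) simp
  also have "\<dots> = q ^ 8" by (simp add: card_cartesian_product card_K flip: power_add)
  finally show "card C \<le> card code" by (simp add: card_code)
qed

end

section \<open>Multiplicative orders and the 2-adic condition\<close>

lemma mult_ord_props:
  fixes x :: "'a::{field,finite}"
  assumes "x \<noteq> 0"
  shows "0 < mult_ord x" and "x ^ j = 1 \<longleftrightarrow> mult_ord x dvd j"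
proof -
  let ?N = "card (UNIV :: 'a set)"
  have "card {0, 1 :: 'a} \<le> ?N" by (intro card_mono) auto
  then have N: "2 \<le> ?N" by simp
  have "x * x ^ (?N - 1) = x"
    using power_card_UNIV[of x] N by (cases ?N) simp_all
  \<comment> \<open>A positive exponent giving 1 exists, so the \<open>LEAST\<close> in
    \<open>mult_ord\<close> is attained.\<close>
  then have "0 < ?N - 1 \<and> x ^ (?N - 1) = 1" using assms N by simp
  then have ord: "0 < mult_ord x \<and> x ^ mult_ord x = 1"
    unfolding mult_ord_def by (rule LeastI)
  then show pos: "0 < mult_ord x" by simp
  have mod: "x ^ j = x ^ (j mod mult_ord x)"
    using ord by (metis div_mult_mod_eq mult.commute mult_1 power_add power_mult power_one)
  show "x ^ j = 1 \<longleftrightarrow> mult_ord x dvd j"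
  proof
    assume "x ^ j = 1"
    then have j: "x ^ (j mod mult_ord x) = 1" using mod by simp
    have "j mod mult_ord x = 0"
    proof (rule ccontr)
      assume "j mod mult_ord x \<noteq> 0"
      then have "mult_ord x \<le> j mod mult_ord x"
        using j unfolding mult_ord_def by (intro Least_le) simp
      then show False using pos mod_less_divisor[OF pos, of j] by linarith
    qed
    then show "mult_ord x dvd j" by auto
  next
    assume "mult_ord x dvd j"
    then show "x ^ j = 1" using mod by simp
  qed
qed

text \<open>Equality of the 2-adic valuations makes \<open>(q - 1) / r\<close> odd, hence coprime to \<open>q\<^sup>2 + 1\<close>.\<close>

lemma dvd_if_order_dvd:
  fixes q r d :: nat
  assumes q: "2 < q" and r: "r dvd q - 1" and v: "multiplicity (2::nat) r = multiplicity 2 (q - 1)"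
    and dvd: "r * (q\<^sup>2 + 1) dvd d * (q - 1)"
  shows "q\<^sup>2 + 1 dvd d"
proof -
  obtain t where t: "q - 1 = r * t" using r by (elim dvdE)
  have "r * t \<noteq> 0" using t q by linarith
  then have nz: "r \<noteq> 0" "t \<noteq> 0" by auto
  have "multiplicity 2 (r * t) = multiplicity 2 r + multiplicity (2::nat) t"
    by (rule prime_elem_multiplicity_mult_distrib) (use nz in auto)
  then have "multiplicity (2::nat) t = 0" using v t by simp
  then have odd: "\<not> 2 dvd t" using nz multiplicity_eq_zero_iff[of t 2] by auto
  have "coprime (q\<^sup>2 + 1) t"
  proof (rule coprimeI)
    fix c assume c: "c dvd q\<^sup>2 + 1" "c dvd t"
    then have "c dvd (q - 1) * (q + 1)" unfolding t by simp
    \<comment> \<open>A common divisor of \<open>q\<^sup>2 + 1\<close> and \<open>t\<close> thus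
      divides 2, while \<open>t\<close> is odd.\<close>
    moreover have "q\<^sup>2 + 1 = (q - 1) * (q + 1) + 2"
      using q by (cases q) (simp_all add: power2_eq_square)
    ultimately have "c dvd 2" using c(1) by (metis dvd_add_right_iff)
    then have "c = 1 \<or> c = 2"
      using two_is_prime_nat prime_nat_iff by blast
    then show "is_unit c" using c(2) odd by auto
  qed
  moreover have "r * (q\<^sup>2 + 1) dvd r * (d * t)" using dvd unfolding t by (simp only: ac_simps)
  then have "q\<^sup>2 + 1 dvd d * t" using nz(1) unfolding nat_mult_dvd_cancel_disj by blast
  ultimately show ?thesis by (simp add: coprime_dvd_mult_left_iff)
qed

theorem theorem3p4:
  fixes p m q n r :: nat and lam delta :: "'b::{field,finite}"
  assumes "prime p" and "0 < m" and "q = p ^ m" and "q > 2" and "n = q^2 + 1"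
    and "card (UNIV :: 'b set) = q^4"
    and "lam \<in> subfield_of_size (q^2)" and "lam \<noteq> 0"
    and "r = mult_ord lam" and "r dvd (q - 1)"
    and "multiplicity (2::nat) r = multiplicity (2::nat) (q - 1)"
    and "mult_ord delta = r * n" and "delta ^ n = lam"
  shows
    "let K = subfield_of_size (q^2) :: 'b set;
         g1 = [:- delta, 1:] * [:- (delta ^ (q^2)), 1:];
         g2 = [:- (delta ^ (q^2 - q + 1)), 1:] * [:- (delta ^ (q^4 - q^3 + q^2)), 1:];
         C = constacyclic_code_check K n lam (g1 * g2);
         D = dual_code K n C;
         Q = int q
     in card C = (q^2)^4 \<and> min_dist n C = q^2 - q \<and>
        weight_enum n C =
          1 + monom (Q^5 - Q) (q^2 - q)
            + monom ((Q^4 - 1) * (Q - 1) * Q^3 div 2) (q^2 - 1)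
            + monom ((Q^4 - 1) * (Q - 1) * Q^3 div 2) (q^2 + 1)
            + monom (Q^7 - Q^5 + Q^4 - Q^3 + Q - 1) (q^2) \<and>
        is_design 3 (q^2 + 1) (q^2 - q) ((q^2 - q - 1) * (q - 2)) (blocks n C (q^2 - q)) \<and>
        card D = (q^2)^(q^2 - 3) \<and> min_dist n D = 4 \<and>
        is_design 3 (q^2 + 1) 4 (q - 2) (blocks n D 4)"
proof -
  have char: "CHAR('b) = p"
    by (rule CHAR_eq_if_card_prime_power[OF assms(1)])
      (simp add: assms(6) assms(3) power_mult[symmetric])
  have delta0: "delta \<noteq> 0" using assms(5,8,13) by auto
  have lam1: "lam ^ (q - 1) = 1"
    using mult_ord_props(2)[OF assms(8)] assms(9,10) by simp
  interpret quartic_field q "\<lambda>x :: 'b. x ^ q"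
  proof
    show "(x + y) ^ q = x ^ q + y ^ q" for x y :: 'b
      by (rule freshmans_dream'[where n = m]) (use assms(1,3) char in simp_all)
  qed (use assms in simp_all)
  interpret constacyclic q "\<lambda>x :: 'b. x ^ q" n lam delta
  proof unfold_locales
    have "lam ^ q = lam * lam ^ (q - 1)" using assms(4) by (cases q) simp_all
    then show "lam \<in> k" using lam1 by (simp add: k_def)
  next
    fix d assume "delta ^ (d * (q - 1)) = 1"
    then have "r * n dvd d * (q - 1)"
      using mult_ord_props(2)[OF delta0] assms(12) by simp
    then show "n dvd d"
      unfolding assms(5) using dvd_if_order_dvd assms(4,10,11) by blast
  qed (use assms in simp_all)
  have K: "subfield_of_size (q\<^sup>2) = K"
    by (simp add: K_def subfield_of_size_def power_mult[symmetric] power2_eq_square)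
  have "delta ^ ((q\<^sup>2 + 1) * (q - 1)) = 1"
    using assms(5,13) lam1 by (simp only: power_mult)
  \<comment> \<open>As \<open>delta ^ (n * (q - 1)) = lam ^ (q - 1) = 1\<close>, the exponent
    \<open>q\<^sup>2 - q + 1\<close> acts on \<open>delta\<close> like \<open>q ^ 3\<close>.\<close>
  moreover have "q ^ 3 = q\<^sup>2 - q + 1 + (q\<^sup>2 + 1) * (q - 1)"
  proof -
    have "q\<^sup>2 - q = q * (q - 1)" by (simp add: power2_eq_square diff_mult_distrib2)
    then show ?thesis using assms(4) by (cases q) (simp_all add: eval_nat_numeral algebra_simps)
  qed
  ultimately have d3: "delta ^ (q\<^sup>2 - q + 1) = delta ^ q ^ 3"
    by (simp only: power_add mult_1_right)
  \<comment> \<open>The fourth root is thus the fifth Frobenius image of \<open>delta\<close>, which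
    is the first because \<phi> has fourth power the identity.\<close>
  have "q ^ 4 - q ^ 3 + q\<^sup>2 = (q\<^sup>2 - q + 1) * q\<^sup>2"
    by (simp add: add_mult_distrib diff_mult_distrib flip: power_add power_Suc)
  then have "delta ^ (q ^ 4 - q ^ 3 + q\<^sup>2) = (delta ^ q ^ 3) ^ q\<^sup>2"
    by (simp only: power_mult d3)
  also have "\<dots> = delta ^ q"
    using phi4[of "delta ^ q"] by (simp only: phi2[symmetric] phi3[symmetric])
  finally have d1: "delta ^ (q ^ 4 - q ^ 3 + q\<^sup>2) = delta ^ q" .
  have "[:- delta, 1:] * [:- (delta ^ q\<^sup>2), 1:] *
      ([:- (delta ^ (q\<^sup>2 - q + 1)), 1:] * [:- (delta ^ (q ^ 4 - q ^ 3 + q\<^sup>2)), 1:]) = h"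
    unfolding h_eq d3 d1 by (simp only: phi3[symmetric] phi2)
  then have C: "constacyclic_code_check K n lam ([:- delta, 1:] * [:- (delta ^ q\<^sup>2), 1:] *
      ([:- (delta ^ (q\<^sup>2 - q + 1)), 1:] * [:- (delta ^ (q ^ 4 - q ^ 3 + q\<^sup>2)), 1:])) = code"
    using C_eq_code C_def by simp
  have "card code = (q\<^sup>2) ^ 4" by (simp add: card_code power_mult[symmetric])
  then show ?thesis
    unfolding Let_def K C
    using min_dist_code weight_enum_code design_code card_dual min_dist_dual design_dual by blast
qed

end
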